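(* Let $n\ge0$ and $k\in\mathbb N\cup\{\infty\}$. Let $\rho_n=id_{n+1}\otimes(e_{22}^* )^{\otimes[n+2,\infty)}$ be the slice map on $\mathrm{UHF}(3^\infty)$ that is the identity on the first $n+1$ tensor factors and applies the state $e_{22}^*$ to each of the remaining ones (with value in $M_3(\mathbb C)^{\otimes(n+1)}\cong M_3(\mathbb C)^{\otimes(n+1)}\otimes I_{[n+2,\infty)}\subset\mathrm{UHF}(3^\infty)$). Then $\rho_n$ restricts to a $C^*$-algebra morphism $\rho_n:\mathcal A_{n+k}\to\mathcal A_n$ (where $\mathcal A_{n+\infty}=\mathcal A_\infty$).
   Context: Indices $j\in\{1,2,3\}$ are taken mod $3$. $M_3(\mathbb C)$ has matrix units $e_{ij}$; $e_{22}^*$ is the state $m\mapsto m_{22}$ on $M_3(\mathbb C)$; $id_{n+1}$ is the identity map of $M_3(\mathbb C)^{\otimes(n+1)}$. $\mathrm{UHF}(3^\infty)$ is the $C^*$-inductive limit of $M_3(\mathbb C)^{\otimes n}$ under $x\mapsto x\otimes I_3$; each $M_3(\mathbb C)^{\otimes n}$ is regarded as a unital subalgebra of it. For $n\ge0$ put $\alpha^n_j=e_{jj}\otimes e_{22}^{\otimes n}\in M_3(\mathbb C)^{\otimes(n+1)}$, and for $k\ge1$ put $\beta^k_j=(e_{jj}\otimes e_{11}+e_{j+2,j+2}\otimes e_{33})\otimes e_{22}^{\otimes(k-1)}\in M_3(\mathbb C)^{\otimes(k+1)}$. The finite-dimensional $*$-algebra $\mathcal A_n\subset M_3(\mathbb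 C)^{\otimes(n+1)}$ is the linear span of the $\alpha^n_j$ and of the $x\otimes\beta^k_j$ with $j=1,2,3$, $k=1,\dots,n$, $x\in M_3(\mathbb C)^{\otimes(n-k)}$. $\mathcal A_\infty$ is the $C^*$-subalgebra of $\mathrm{UHF}(3^\infty)$ of all norm limits $\lim_n a_n$ with $a_n\in\mathcal A_n$. For any state $\omega$ on $M_3(\mathbb C)$, the map $id_{n+1}\otimes\omega^{\otimes[n+2,\infty)}$ is the unique bounded linear map on $\mathrm{UHF}(3^\infty)$ with $x_0\otimes x_1\otimes\cdots\otimes x_p\mapsto \omega(x_1)\cdots\omega(x_p)\,x_0$ for $x_0\in M_3(\mathbb C)^{\otimes(n+1)}$, $x_i\in M_3(\mathbb C)$; it is a completely positive contraction. *)

theory Defs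
  imports "HOL-Analysis.Analysis" "HOL-Library.Extended_Nat"
begin

section \<open>C*-algebras\<close>

text \<open>Unital complex algebras with an involution \<^term>\<open>adj\<close> and a (not necessarily complete) C*-norm.\<close>

class pre_cstar_algebra = real_normed_algebra_1 +
  fixes scaleC :: "complex \<Rightarrow> 'a \<Rightarrow> 'a"  (infixr \<open>*\<^sub>C\<close> 75)
    and adj :: "'a \<Rightarrow> 'a"
  assumes scaleC_add_right: "c *\<^sub>C (x + y) = c *\<^sub>C x + c *\<^sub>C y"
    and scaleC_add_left: "(c + d) *\<^sub>C x = c *\<^sub>C x + d *\<^sub>C x"
    and scaleC_scaleC: "c *\<^sub>C d *\<^sub>C x = (c * d) *\<^sub>C x"
    and scaleC_of_real: "complex_of_real r *\<^sub>C x = r *\<^sub>R x"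
    and mult_scaleC_left: "(c *\<^sub>C x) * y = c *\<^sub>C (x * y)"
    and mult_scaleC_right: "x * (c *\<^sub>C y) = c *\<^sub>C (x * y)"
    and norm_scaleC: "norm (c *\<^sub>C x) = cmod c * norm x"
    and adj_add: "adj (x + y) = adj x + adj y"
    and adj_scaleC: "adj (c *\<^sub>C x) = cnj c *\<^sub>C adj x"
    and adj_mult: "adj (x * y) = adj y * adj x"
    and adj_adj: "adj (adj x) = x"
    and cstar_identity: "norm (adj x * x) = (norm x)\<^sup>2"

class cstar_algebra = pre_cstar_algebra + banach

lemma scaleC_one: "1 *\<^sub>C x = (x::'a::pre_cstar_algebra)"
  using scaleC_of_real[of 1 x] by simp

interpretation complex_vector: vector_space "scaleC :: complex \<Rightarrow> 'a \<Rightarrow> 'a::pre_cstar_algebra"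
  by standard (simp_all add: scaleC_add_right scaleC_add_left scaleC_scaleC scaleC_one)

lemma adj_diff: "adj (x - y) = adj x - adj (y::'a::pre_cstar_algebra)"
  by (metis add_diff_cancel adj_add diff_add_cancel)

lemma norm_adj: "norm (adj x) = norm (x::'a::pre_cstar_algebra)"
proof -
  have *: "norm y \<le> norm (adj y)" for y :: 'a
  proof (cases "y = 0")
    case False
    have "norm y * norm y \<le> norm (adj y) * norm y"
      using norm_mult_ineq[of "adj y" y] cstar_identity[of y] by (simp add: power2_eq_square)
    with False show ?thesis by simp
  qed simp
  show ?thesis
    using *[of x] *[of "adj x"] by (simp add: adj_adj)
qed

definition bounded_clinear :: "('a::pre_cstar_algebra \<Rightarrow> 'b::pre_cstar_algebra) \<Rightarrow> bool" where
  "bounded_clinear f \<longleftrightarrow> bounded_linear f \<and> (\<forall>c x. f (c *\<^sub>C x) = c *\<^sub>C f x)"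

definition cstar_subalgebra :: "'a::cstar_algebra set \<Rightarrow> bool" where
  "cstar_subalgebra A \<longleftrightarrow> complex_vector.subspace A \<and> closed A \<and>
     (\<forall>x\<in>A. \<forall>y\<in>A. x * y \<in> A) \<and> (\<forall>x\<in>A. adj x \<in> A)"

text \<open>A morphism of C*-algebras is a *-homomorphism between C*-algebras; it is not required to be
  unital. Boundedness is automatic. The map may be defined on a larger algebra, in which case
  this says that it restricts to a morphism from \<^term>\<open>A\<close> to \<^term>\<open>B\<close>.\<close>

definition cstar_morphism :: "'a::cstar_algebra set \<Rightarrow> 'b::cstar_algebra set \<Rightarrow> ('a \<Rightarrow> 'b) \<Rightarrow> bool" where
  "cstar_morphism A B f \<longleftrightarrow> cstar_subalgebra A \<and> cstar_subalgebra B \<and> f \<in> A \<rightarrow> B \<and>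
     (\<forall>x\<in>A. \<forall>y\<in>A. f (x + y) = f x + f y \<and> f (x * y) = f x * f y) \<and>
     (\<forall>c. \<forall>x\<in>A. f (c *\<^sub>C x) = c *\<^sub>C f x) \<and> (\<forall>x\<in>A. f (adj x) = adj (f x))"

section \<open>The completion of a pre-C*-algebra\<close>

text \<open>Cauchy sequences modulo null sequences.\<close>

definition cauchy_rel :: "(nat \<Rightarrow> 'a::real_normed_vector) \<Rightarrow> (nat \<Rightarrow> 'a) \<Rightarrow> bool" where
  "cauchy_rel X Y \<longleftrightarrow> Cauchy X \<and> Cauchy Y \<and> (\<lambda>n. X n - Y n) \<longlonglongrightarrow> 0"

lemma cauchy_rel_trans:
  assumes "cauchy_rel X Y" "cauchy_rel Y Z" shows "cauchy_rel X Z"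
proof -
  have "(\<lambda>n. (X n - Y n) + (Y n - Z n)) \<longlonglongrightarrow> 0 + 0"
    using assms unfolding cauchy_rel_def by (intro tendsto_add) auto
  then show ?thesis using assms unfolding cauchy_rel_def by simp
qed

lemma cauchy_rel_sym:
  assumes "cauchy_rel X Y" shows "cauchy_rel Y X"
proof -
  have "(\<lambda>n. - (X n - Y n)) \<longlonglongrightarrow> - 0"
    using assms unfolding cauchy_rel_def by (intro tendsto_minus) auto
  then show ?thesis using assms unfolding cauchy_rel_def by simp
qed

lemma cauchy_rel_const: "cauchy_rel (\<lambda>n. a) (\<lambda>n. a)"
  unfolding cauchy_rel_def by (simp add: Cauchy_convergent_iff convergent_Cauchy convergent_const)

lemma part_equivp_cauchy_rel: "part_equivp (cauchy_rel :: (nat \<Rightarrow> 'a::real_normed_vector) \<Rightarrow> _)"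
  by (intro part_equivpI sympI transpI exI[of _ "\<lambda>n. 0"] cauchy_rel_const)
     (blast intro: cauchy_rel_sym cauchy_rel_trans)+

quotient_type (overloaded) 'a completion = "nat \<Rightarrow> 'a::real_normed_vector" / partial: cauchy_rel
  by (rule part_equivp_cauchy_rel)

lemma cauchy_rel_bounded_linear:
  assumes "bounded_linear f" "cauchy_rel X Y"
  shows "cauchy_rel (\<lambda>n. f (X n)) (\<lambda>n. f (Y n))"
proof -
  have "(\<lambda>n. f (X n - Y n)) \<longlonglongrightarrow> 0"
    using assms by (intro bounded_linear.tendsto_zero[OF assms(1)]) (auto simp: cauchy_rel_def)
  then show ?thesis
    using assms by (auto simp: cauchy_rel_def linear_diff bounded_linear.linear
        intro: bounded_linear.Cauchy)
qed

lemma Cauchy_plus: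
  fixes X Y :: "nat \<Rightarrow> 'a::real_normed_vector"
  assumes X: "Cauchy X" and Y: "Cauchy Y" shows "Cauchy (\<lambda>n. X n + Y n)"
proof (rule CauchyI)
  fix e :: real assume e: "0 < e"
  obtain M where M: "\<And>m n. m \<ge> M \<Longrightarrow> n \<ge> M \<Longrightarrow> norm (X m - X n) < e/2"
    using CauchyD[OF X, of "e/2"] e by auto
  obtain N where N: "\<And>m n. m \<ge> N \<Longrightarrow> n \<ge> N \<Longrightarrow> norm (Y m - Y n) < e/2"
    using CauchyD[OF Y, of "e/2"] e by auto
  show "\<exists>M. \<forall>m\<ge>M. \<forall>n\<ge>M. norm (X m + Y m - (X n + Y n)) < e"
  proof (intro exI[of _ "max M N"] allI impI)
    fix m n assume "m \<ge> max M N" "n \<ge> max M N"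
    then show "norm (X m + Y m - (X n + Y n)) < e"
      using M[of m n] N[of m n] norm_triangle_ineq[of "X m - X n" "Y m - Y n"]
      by (simp add: algebra_simps)
  qed
qed

lemma cauchy_rel_add:
  assumes "cauchy_rel X Y" "cauchy_rel X' Y'"
  shows "cauchy_rel (\<lambda>n. X n + X' n) (\<lambda>n. Y n + Y' n)"
proof -
  have "(\<lambda>n. (X n - Y n) + (X' n - Y' n)) \<longlonglongrightarrow> 0 + 0"
    using assms unfolding cauchy_rel_def by (intro tendsto_add) auto
  then show ?thesis using assms unfolding cauchy_rel_def
    by (auto intro!: Cauchy_plus simp: algebra_simps)
qed

lemma cauchy_rel_mult:
  fixes X Y :: "nat \<Rightarrow> 'a::real_normed_algebra"
  assumes "cauchy_rel X Y" "cauchy_rel X' Y'"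
  shows "cauchy_rel (\<lambda>n. X n * X' n) (\<lambda>n. Y n * Y' n)"
proof -
  have C: "Cauchy (\<lambda>n. U n * V n)" if U: "Cauchy U" and V: "Cauchy V" for U V :: "nat \<Rightarrow> 'a"
  proof (rule CauchyI)
    fix e :: real assume e: "0 < e"
    obtain B where B: "B > 0" "\<And>n. norm (U n) \<le> B" "\<And>n. norm (V n) \<le> B"
    proof -
      obtain K where "K > 0" "\<forall>n. norm (U n) \<le> K" using Cauchy_Bseq[OF U] by (auto simp: Bseq_def)
      moreover obtain L where "L > 0" "\<forall>n. norm (V n) \<le> L" using Cauchy_Bseq[OF V] by (auto simp: Bseq_def)
      ultimately show ?thesis
        by (intro that[of "max K L"]) (auto simp: le_max_iff_disj)
    qed
    define d where "d = e / (4 * B)"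
    have d: "d > 0" using e B by (simp add: d_def)
    obtain M where M: "\<And>m n. m \<ge> M \<Longrightarrow> n \<ge> M \<Longrightarrow> norm (U m - U n) < d" using CauchyD[OF U d] by blast
    obtain N where N: "\<And>m n. m \<ge> N \<Longrightarrow> n \<ge> N \<Longrightarrow> norm (V m - V n) < d" using CauchyD[OF V d] by blast
    show "\<exists>M. \<forall>m\<ge>M. \<forall>n\<ge>M. norm (U m * V m - U n * V n) < e"
    proof (intro exI[of _ "max M N"] allI impI)
      fix m n assume mn: "m \<ge> max M N" "n \<ge> max M N"
      have "U m * V m - U n * V n = U m * (V m - V n) + (U m - U n) * V n"
        by (simp add: algebra_simps)
      also have "norm \<dots> \<le> norm (U m) * norm (V m - V n) + norm (U m - U n) * norm (V n)"
        by (meson add_mono norm_mult_ineq norm_triangle_le)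
      also have "\<dots> \<le> B * d + d * B"
        using mn M[of m n] N[of m n] B d by (intro add_mono mult_mono) (auto intro: less_imp_le)
      also have "\<dots> = e / 2" using B by (simp add: d_def field_simps)
      also have "\<dots> < e" using e by simp
      finally show "norm (U m * V m - U n * V n) < e" .
    qed
  qed
  have 1: "(\<lambda>n. X n * (X' n - Y' n)) \<longlonglongrightarrow> 0"
  proof -
    have "Zfun (\<lambda>n. X' n - Y' n) sequentially"
      using assms(2) by (simp add: cauchy_rel_def tendsto_Zfun_iff)
    moreover have "Bfun X sequentially"
      using assms(1) Cauchy_Bseq by (auto simp: cauchy_rel_def)
    ultimately show ?thesis
      unfolding tendsto_Zfun_iff
      using bounded_bilinear.Bfun_prod_Zfun[OF bounded_bilinear_mult] by simp
  qed
  have 2: "(\<lambda>n. (X n - Y n) * Y' n) \<longlonglongrightarrow> 0"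
  proof -
    have "Zfun (\<lambda>n. X n - Y n) sequentially"
      using assms(1) by (simp add: cauchy_rel_def tendsto_Zfun_iff)
    moreover have "Bfun Y' sequentially"
      using assms(2) Cauchy_Bseq by (auto simp: cauchy_rel_def)
    ultimately show ?thesis
      unfolding tendsto_Zfun_iff
      using bounded_bilinear.Zfun_prod_Bfun[OF bounded_bilinear_mult] by simp
  qed
  have "(\<lambda>n. X n * (X' n - Y' n) + (X n - Y n) * Y' n) \<longlonglongrightarrow> 0 + 0"
    by (rule tendsto_add[OF 1 2])
  then show ?thesis
    using assms C unfolding cauchy_rel_def by (simp add: algebra_simps)
qed

lemma cauchy_norm_convergent:
  fixes X :: "nat \<Rightarrow> 'a::real_normed_vector"
  assumes X: "Cauchy X" shows "convergent (\<lambda>n. norm (X n))"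
proof (rule real_Cauchy_convergent, rule CauchyI)
  fix e :: real assume "0 < e"
  then obtain M where M: "\<And>m n. m \<ge> M \<Longrightarrow> n \<ge> M \<Longrightarrow> norm (X m - X n) < e"
    using CauchyD[OF X] by blast
  show "\<exists>M. \<forall>m\<ge>M. \<forall>n\<ge>M. norm (norm (X m) - norm (X n)) < e"
    using M by (auto intro!: exI[of _ M] le_less_trans[OF norm_triangle_ineq3])
qed

lemma cauchy_rel_lim_norm:
  assumes "cauchy_rel X Y" shows "lim (\<lambda>n. norm (X n)) = lim (\<lambda>n. norm (Y n))"
proof -
  have "(\<lambda>n. norm (X n - Y n)) \<longlonglongrightarrow> 0"
    using assms by (simp add: cauchy_rel_def tendsto_norm_zero)
  then have "(\<lambda>n. norm (X n) - norm (Y n)) \<longlonglongrightarrow> 0"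
    by (rule Lim_null_comparison[rotated]) (simp add: norm_triangle_ineq3)
  moreover have "(\<lambda>n. norm (X n) - norm (Y n)) \<longlonglongrightarrow> lim (\<lambda>n. norm (X n)) - lim (\<lambda>n. norm (Y n))"
    using assms cauchy_norm_convergent unfolding cauchy_rel_def convergent_LIMSEQ_iff
    by (intro tendsto_diff) auto
  ultimately show ?thesis using LIMSEQ_unique by fastforce
qed

lemma bounded_linear_scaleC: "bounded_linear (\<lambda>x::'a::pre_cstar_algebra. c *\<^sub>C x)"
  by (rule bounded_linear_intro[of _ "cmod c"])
    (simp_all add: scaleC_add_right norm_scaleC mult.commute scaleC_scaleC flip: scaleC_of_real)

lemma bounded_linear_adj: "bounded_linear (adj :: 'a \<Rightarrow> 'a::pre_cstar_algebra)"
proof (rule bounded_linear_intro[of _ 1])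
  show "adj (r *\<^sub>R x) = r *\<^sub>R adj x" for r and x :: 'a
    using adj_scaleC[of "complex_of_real r" x] by (simp add: scaleC_of_real)
qed (simp_all add: adj_add norm_adj)

instantiation completion :: (pre_cstar_algebra) pre_cstar_algebra
begin

lift_definition zero_completion :: "'a completion" is "\<lambda>n. 0" by (rule cauchy_rel_const)
lift_definition one_completion :: "'a completion" is "\<lambda>n. 1" by (rule cauchy_rel_const)
lift_definition plus_completion :: "'a completion \<Rightarrow> 'a completion \<Rightarrow> 'a completion"
  is "\<lambda>X Y n. X n + Y n" by (rule cauchy_rel_add)
lift_definition uminus_completion :: "'a completion \<Rightarrow> 'a completion"
  is "\<lambda>X n. - X n" by (rule cauchy_rel_bounded_linear[OF bounded_linear_minus[OF bounded_linear_ident]])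
definition minus_completion :: "'a completion \<Rightarrow> 'a completion \<Rightarrow> 'a completion" where
  "minus_completion x y = x + - y"
lift_definition times_completion :: "'a completion \<Rightarrow> 'a completion \<Rightarrow> 'a completion"
  is "\<lambda>X Y n. X n * Y n" by (rule cauchy_rel_mult)
lift_definition scaleC_completion :: "complex \<Rightarrow> 'a completion \<Rightarrow> 'a completion"
  is "\<lambda>c X n. c *\<^sub>C X n" by (rule cauchy_rel_bounded_linear[OF bounded_linear_scaleC])
lift_definition scaleR_completion :: "real \<Rightarrow> 'a completion \<Rightarrow> 'a completion"
  is "\<lambda>r X n. r *\<^sub>R X n" by (rule cauchy_rel_bounded_linear[OF bounded_linear_scaleR_right])
lift_definition adj_completion :: "'a completion \<Rightarrow> 'a completion"
  is "\<lambda>X n. adj (X n)" by (rule cauchy_rel_bounded_linear[OF bounded_linear_adj])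
lift_definition norm_completion :: "'a completion \<Rightarrow> real"
  is "\<lambda>X. lim (\<lambda>n. norm (X n))" by (rule cauchy_rel_lim_norm)
definition dist_completion :: "'a completion \<Rightarrow> 'a completion \<Rightarrow> real" where
  "dist_completion x y = norm (x - y)"
definition sgn_completion :: "'a completion \<Rightarrow> 'a completion" where
  "sgn_completion x = scaleR (inverse (norm x)) x"
definition uniformity_completion :: "('a completion \<times> 'a completion) filter" where
  "uniformity_completion = (INF e\<in>{0 <..}. principal {(x, y). dist x y < e})"
definition open_completion :: "'a completion set \<Rightarrow> bool" where
  "open_completion U \<longleftrightarrow> (\<forall>x\<in>U. eventually (\<lambda>(x', y). x' = x \<longrightarrow> y \<in> U) uniformity)"

instance
proof
  have refl: "cauchy_rel X X \<longleftrightarrow> Cauchy X" for X :: "nat \<Rightarrow> 'a" by (simp add: cauchy_rel_def)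
  have nlim: "(\<lambda>n. norm (X n)) \<longlonglongrightarrow> lim (\<lambda>n. norm (X n))" if "Cauchy X" for X :: "nat \<Rightarrow> 'a"
    using cauchy_norm_convergent[OF that] by (simp add: convergent_LIMSEQ_iff)
  have mkrel: "cauchy_rel X Y" if "cauchy_rel X X" "\<And>n. X n = Y n" for X Y :: "nat \<Rightarrow> 'a"
  proof -
    have "X = Y" using that(2) by auto
    then show ?thesis using that(1) by simp
  qed
  note R = cauchy_rel_add cauchy_rel_mult cauchy_rel_const
    cauchy_rel_bounded_linear[OF bounded_linear_scaleC]
    cauchy_rel_bounded_linear[OF bounded_linear_scaleR_right]
    cauchy_rel_bounded_linear[OF bounded_linear_adj]
    cauchy_rel_bounded_linear[OF bounded_linear_minus[OF bounded_linear_ident]]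
  fix a b c :: "'a completion" and k l :: complex and r s :: real and U :: "'a completion set"
  show "a + b + c = a + (b + c)" by transfer (rule mkrel; (intro R | simp add: algebra_simps); assumption?)
  show "a + b = b + a" by transfer (rule mkrel; (intro R | simp add: algebra_simps); assumption?)
  show "0 + a = a" by transfer (rule mkrel; (intro R | simp add: algebra_simps); assumption?)
  show "- a + a = 0" by transfer (rule mkrel; (intro R | simp add: algebra_simps); assumption?)
  show "a - b = a + - b" by (rule minus_completion_def)
  show "r *\<^sub>R (a + b) = r *\<^sub>R a + r *\<^sub>R b" by transfer (rule mkrel; (intro R | simp add: algebra_simps); assumption?)
  show "(r + s) *\<^sub>R a = r *\<^sub>R a + s *\<^sub>R a" by transfer (rule mkrel; (intro R | simp add: algebra_simps); assumption?)
  show "r *\<^sub>R s *\<^sub>R a = (r * s) *\<^sub>R a" by transfer (rule mkrel; (intro R | simp add: algebra_simps); assumption?)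
  show "1 *\<^sub>R a = a" by transfer (rule mkrel; (intro R | simp add: algebra_simps); assumption?)
  show "a * b * c = a * (b * c)" by transfer (rule mkrel; (intro R | simp add: algebra_simps); assumption?)
  show "(a + b) * c = a * c + b * c" by transfer (rule mkrel; (intro R | simp add: algebra_simps); assumption?)
  show "a * (b + c) = a * b + a * c" by transfer (rule mkrel; (intro R | simp add: algebra_simps); assumption?)
  show "r *\<^sub>R a * b = r *\<^sub>R (a * b)" by transfer (rule mkrel; (intro R | simp add: algebra_simps); assumption?)
  show "a * r *\<^sub>R b = r *\<^sub>R (a * b)" by transfer (rule mkrel; (intro R | simp add: algebra_simps); assumption?)
  show "1 * a = a" by transfer (rule mkrel; (intro R | simp add: algebra_simps); assumption?)
  show "a * 1 = a" by transfer (rule mkrel; (intro R | simp add: algebra_simps); assumption?)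
  show "(0::'a completion) \<noteq> 1"
    by transfer (auto simp: cauchy_rel_def LIMSEQ_const_iff)
  show "dist a b = norm (a - b)" by (rule dist_completion_def)
  show "sgn a = inverse (norm a) *\<^sub>R a" by (rule sgn_completion_def)
  show "uniformity = (INF e\<in>{0 <..}. principal {(x, y::'a completion). dist x y < e})"
    by (rule uniformity_completion_def)
  show "open U \<longleftrightarrow> (\<forall>x\<in>U. eventually (\<lambda>(x', y). x' = x \<longrightarrow> y \<in> U) uniformity)"
    by (rule open_completion_def)
  show "norm a = 0 \<longleftrightarrow> a = 0"
  proof transfer
    fix X :: "nat \<Rightarrow> 'a" assume "cauchy_rel X X"
    then have X: "Cauchy X" by (simp add: refl)
    show "lim (\<lambda>n. norm (X n)) = 0 \<longleftrightarrow> cauchy_rel X (\<lambda>n. 0)"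
      using nlim[OF X] X cauchy_rel_const[of "0::'a"]
      by (auto simp: cauchy_rel_def tendsto_norm_zero_iff dest: tendsto_norm_zero limI)
  qed
  show "norm (a + b) \<le> norm a + norm b"
  proof transfer
    fix X Y :: "nat \<Rightarrow> 'a" assume "cauchy_rel X X" "cauchy_rel Y Y"
    then have X: "Cauchy X" and Y: "Cauchy Y" by (simp_all add: refl)
    show "lim (\<lambda>n. norm (X n + Y n)) \<le> lim (\<lambda>n. norm (X n)) + lim (\<lambda>n. norm (Y n))"
      by (rule LIMSEQ_le[OF nlim[OF Cauchy_plus[OF X Y]] tendsto_add[OF nlim[OF X] nlim[OF Y]]])
         (simp add: norm_triangle_ineq)
  qed
  show "norm (r *\<^sub>R a) = \<bar>r\<bar> * norm a"
  proof transfer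
    fix r and X :: "nat \<Rightarrow> 'a" assume "cauchy_rel X X"
    then have X: "Cauchy X" by (simp add: refl)
    show "lim (\<lambda>n. norm (r *\<^sub>R X n)) = \<bar>r\<bar> * lim (\<lambda>n. norm (X n))"
      using tendsto_mult_left[OF nlim[OF X], of "\<bar>r\<bar>"] by (simp add: limI)
  qed
  show "norm (a * b) \<le> norm a * norm b"
  proof transfer
    fix X Y :: "nat \<Rightarrow> 'a" assume XY: "cauchy_rel X X" "cauchy_rel Y Y"
    then have X: "Cauchy X" and Y: "Cauchy Y" by (simp_all add: refl)
    have P: "Cauchy (\<lambda>n. X n * Y n)" using cauchy_rel_mult[OF XY] by (simp add: refl)
    show "lim (\<lambda>n. norm (X n * Y n)) \<le> lim (\<lambda>n. norm (X n)) * lim (\<lambda>n. norm (Y n))"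
      by (rule LIMSEQ_le[OF nlim[OF P] tendsto_mult[OF nlim[OF X] nlim[OF Y]]])
         (simp add: norm_mult_ineq)
  qed
  show "norm (1::'a completion) = 1"
    by transfer simp
  show "k *\<^sub>C (a + b) = k *\<^sub>C a + k *\<^sub>C b" by transfer (rule mkrel; (intro R | simp add: scaleC_add_right); assumption?)
  show "(k + l) *\<^sub>C a = k *\<^sub>C a + l *\<^sub>C a" by transfer (rule mkrel; (intro R | simp add: scaleC_add_left); assumption?)
  show "k *\<^sub>C l *\<^sub>C a = (k * l) *\<^sub>C a" by transfer (rule mkrel; (intro R | simp add: scaleC_scaleC); assumption?)
  show "complex_of_real r *\<^sub>C a = r *\<^sub>R a" by transfer (rule mkrel; (intro R | simp add: scaleC_of_real); assumption?)
  show "(k *\<^sub>C a) * b = k *\<^sub>C (a * b)" by transfer (rule mkrel; (intro R | simp add: mult_scaleC_left); assumption?)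
  show "a * (k *\<^sub>C b) = k *\<^sub>C (a * b)" by transfer (rule mkrel; (intro R | simp add: mult_scaleC_right); assumption?)
  show "adj (a + b) = adj a + adj b" by transfer (rule mkrel; (intro R | simp add: adj_add); assumption?)
  show "adj (k *\<^sub>C a) = cnj k *\<^sub>C adj a" by transfer (rule mkrel; (intro R | simp add: adj_scaleC); assumption?)
  show "adj (a * b) = adj b * adj a" by transfer (rule mkrel; (intro R | simp add: adj_mult); assumption?)
  show "adj (adj a) = a" by transfer (rule mkrel; (intro R | simp add: adj_adj); assumption?)
  show "norm (k *\<^sub>C a) = cmod k * norm a"
  proof transfer
    fix k and X :: "nat \<Rightarrow> 'a" assume "cauchy_rel X X"
    then have X: "Cauchy X" by (simp add: refl)
    show "lim (\<lambda>n. norm (k *\<^sub>C X n)) = cmod k * lim (\<lambda>n. norm (X n))"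
      using tendsto_mult_left[OF nlim[OF X], of "cmod k"] by (simp add: limI norm_scaleC)
  qed
  show "norm (adj a * a) = (norm a)\<^sup>2"
  proof transfer
    fix X :: "nat \<Rightarrow> 'a" assume "cauchy_rel X X"
    then have X: "Cauchy X" by (simp add: refl)
    show "lim (\<lambda>n. norm (adj (X n) * X n)) = (lim (\<lambda>n. norm (X n)))\<^sup>2"
      using tendsto_power[OF nlim[OF X], of 2] by (simp add: limI cstar_identity)
  qed
qed

end

lift_definition to_completion :: "'a::pre_cstar_algebra \<Rightarrow> 'a completion" is "\<lambda>a n. a"
  by (rule cauchy_rel_const)


lemma norm_to_completion: "norm (to_completion a) = norm a"
  by transfer simp

lemma to_completion_add: "to_completion (a + b) = to_completion a + to_completion b"
  by transfer (rule cauchy_rel_const)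

lemma to_completion_scaleC: "to_completion (c *\<^sub>C a) = c *\<^sub>C to_completion a"
  by transfer (rule cauchy_rel_const)

lemma to_completion_scaleR: "to_completion (r *\<^sub>R a) = r *\<^sub>R to_completion a"
  by transfer (rule cauchy_rel_const)

lemma to_completion_mult: "to_completion (a * b) = to_completion a * to_completion b"
  by transfer (rule cauchy_rel_const)

lemma to_completion_adj: "to_completion (adj a) = adj (to_completion a)"
  by transfer (rule cauchy_rel_const)

lemma to_completion_one: "to_completion 1 = 1"
  by transfer (rule cauchy_rel_const)

lemma to_completion_diff: "to_completion (a - b) = to_completion a - to_completion b"
  using to_completion_add[of "a - b" b] by (simp add: algebra_simps)

lemma Cauchy_minus_const:
  fixes X :: "nat \<Rightarrow> 'a::real_normed_vector"
  assumes "Cauchy X" shows "Cauchy (\<lambda>n. X n - a)"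
  using assms unfolding Cauchy_iff by simp

lemma lim_norm_le:
  fixes X :: "nat \<Rightarrow> 'a::real_normed_vector"
  assumes X: "Cauchy X" and M: "\<And>n. n \<ge> M \<Longrightarrow> norm (X n) \<le> e"
  shows "lim (\<lambda>n. norm (X n)) \<le> e"
proof (rule LIMSEQ_le_const2)
  show "(\<lambda>n. norm (X n)) \<longlonglongrightarrow> lim (\<lambda>n. norm (X n))"
    using cauchy_norm_convergent[OF X] by (simp add: convergent_LIMSEQ_iff)
  show "\<exists>N. \<forall>n\<ge>N. norm (X n) \<le> e" using M by blast
qed

lemma to_completion_dense:
  assumes "0 < e" obtains a where "norm (x - to_completion a) < e"
proof -
  have "\<exists>a. norm (x + - to_completion a) < e"
    using assms
  proof transfer
    fix e :: real and X :: "nat \<Rightarrow> 'a" assume e: "0 < e" and "cauchy_rel X X"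
    then have X: "Cauchy X" by (simp add: cauchy_rel_def)
    obtain M where M: "\<And>m n. m \<ge> M \<Longrightarrow> n \<ge> M \<Longrightarrow> norm (X m - X n) < e/2"
      using CauchyD[OF X, of "e/2"] e by auto
    have "lim (\<lambda>n. norm (X n - X M)) \<le> e/2"
      by (rule lim_norm_le[OF Cauchy_minus_const[OF X], of M]) (rule less_imp_le, rule M, simp_all)
    then show "\<exists>a. lim (\<lambda>n. norm (X n + - a)) < e"
      using e by (intro exI[of _ "X M"]) auto
  qed
  then show ?thesis using that by auto
qed

lemma to_completion_tendsto:
  assumes "Cauchy X" obtains x where "(\<lambda>n. to_completion (X n)) \<longlonglongrightarrow> x"
proof -
  define x where "x = abs_completion X"
  have n: "norm (x + - to_completion (X m)) = lim (\<lambda>n. norm (X n + - X m))" for m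
  proof -
    have c: "cauchy_rel (\<lambda>n. - X m) (\<lambda>n. - X m)" for m by (rule cauchy_rel_const)
    have r: "cauchy_rel X X" using assms by (simp add: cauchy_rel_def)
    have "to_completion (X m) = abs_completion (\<lambda>n. X m)"
      by (simp add: to_completion.abs_eq)
    then show ?thesis
      unfolding x_def
      by (simp add: uminus_completion.abs_eq[OF cauchy_rel_const]
          plus_completion.abs_eq[OF r c] norm_completion.abs_eq[OF cauchy_rel_add[OF r c]]
          del: add_uminus_conv_diff)
  qed
  have "(\<lambda>m. to_completion (X m)) \<longlonglongrightarrow> x"
  proof (rule LIMSEQ_I)
    fix e :: real assume e: "0 < e"
    obtain M where M: "\<And>m n. m \<ge> M \<Longrightarrow> n \<ge> M \<Longrightarrow> norm (X m - X n) < e/2"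
      using CauchyD[OF assms, of "e/2"] e by auto
    show "\<exists>M. \<forall>m\<ge>M. norm (to_completion (X m) - x) < e"
    proof (intro exI[of _ M] allI impI)
      fix m assume m: "m \<ge> M"
      have "lim (\<lambda>n. norm (X n - X m)) \<le> e/2"
        by (rule lim_norm_le[OF Cauchy_minus_const[OF assms], of M]) (rule less_imp_le, rule M, simp_all add: m)
      then show "norm (to_completion (X m) - x) < e"
        using n[of m] e by (simp add: norm_minus_commute)
    qed
  qed
  then show ?thesis by (rule that)
qed

instance completion :: (pre_cstar_algebra) cstar_algebra
proof
  fix X :: "nat \<Rightarrow> 'a completion" assume X: "Cauchy X"
  have "\<exists>a. norm (X n - to_completion a) < inverse (real (Suc n))" for n
    using to_completion_dense[of "inverse (real (Suc n))" "X n"] by auto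
  then obtain a where a: "\<And>n. norm (X n - to_completion (a n)) < inverse (real (Suc n))" by metis
  have lim0: "(\<lambda>n. X n - to_completion (a n)) \<longlonglongrightarrow> 0"
    by (rule Lim_null_comparison[OF _ LIMSEQ_inverse_real_of_nat])
       (intro always_eventually allI less_imp_le[OF a])
  have "Cauchy (\<lambda>n. X n + - (X n - to_completion (a n)))"
    by (intro Cauchy_plus X convergent_Cauchy convergentI) (rule tendsto_minus[OF lim0])
  then have "Cauchy (\<lambda>n. to_completion (a n))" by simp
  then have "Cauchy a"
    unfolding Cauchy_iff to_completion_diff[symmetric] norm_to_completion .
  then obtain x where "(\<lambda>n. to_completion (a n)) \<longlonglongrightarrow> x" by (rule to_completion_tendsto)
  then have "(\<lambda>n. (X n - to_completion (a n)) + to_completion (a n)) \<longlonglongrightarrow> 0 + x"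
    by (rule tendsto_add[OF lim0])
  then show "convergent X" by (auto simp: convergent_def)
qed

section \<open>The algebraic inductive limit of the matrix algebras\<close>

text \<open>
  The three basis vectors of \<open>\<complex>\<^sup>3\<close> are indexed by the type \<open>3\<close>, whose arithmetic is modulo 3
  (so \<open>3 = 0\<close> there). The basis of \<open>(\<complex>\<^sup>3)\<^sup>\<otimes>\<^sup>n\<close> is indexed by words of length \<open>n\<close>, and an element
  of the \<open>n\<close>-fold tensor power of the 3 by 3 matrices is a matrix \<open>a\<close> indexed by such words.
  It is represented by the matrix \<open>amplify n a\<close> of \<open>a \<otimes> I \<otimes> I \<otimes> \<dots>\<close>, with rows and columns indexed by
  infinite words. In this way the embeddings \<open>x \<mapsto> x \<otimes> I\<close> become inclusions. The C*-norm is the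
  operator norm on finitely supported vectors; on \<open>amplify n a\<close> it is the operator norm of \<open>a\<close>,
  because \<open>amplify n a\<close> is a direct sum of copies of \<open>a\<close>, one for each tail of an infinite word.
\<close>

type_synonym index_word = "nat \<Rightarrow> 3"

typedef fin_vec = "{\<xi> :: index_word \<Rightarrow> complex. finite {s. \<xi> s \<noteq> 0}}"
  morphisms coord Abs_fin_vec
  by (rule exI[of _ "\<lambda>s. 0"]) simp

setup_lifting type_definition_fin_vec

lemma finite_coord: "finite {s. coord \<xi> s \<noteq> 0}"
  using coord[of \<xi>] by simp

lemma fin_vec_eqI: "(\<And>s. coord \<xi> s = coord \<eta> s) \<Longrightarrow> \<xi> = \<eta>"
  by (simp add: coord_inject[symmetric] fun_eq_iff)

instantiation fin_vec :: real_inner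
begin

lift_definition zero_fin_vec :: fin_vec is "\<lambda>s. 0" by simp
lift_definition plus_fin_vec :: "fin_vec \<Rightarrow> fin_vec \<Rightarrow> fin_vec" is "\<lambda>\<xi> \<eta> s. \<xi> s + \<eta> s"
proof -
  fix \<xi> \<eta> :: "index_word \<Rightarrow> complex" assume "finite {s. \<xi> s \<noteq> 0}" "finite {s. \<eta> s \<noteq> 0}"
  then show "finite {s. \<xi> s + \<eta> s \<noteq> 0}"
    by - (rule finite_subset[of _ "{s. \<xi> s \<noteq> 0} \<union> {s. \<eta> s \<noteq> 0}"], auto)
qed
lift_definition minus_fin_vec :: "fin_vec \<Rightarrow> fin_vec \<Rightarrow> fin_vec" is "\<lambda>\<xi> \<eta> s. \<xi> s - \<eta> s"
proof -
  fix \<xi> \<eta> :: "index_word \<Rightarrow> complex" assume "finite {s. \<xi> s \<noteq> 0}" "finite {s. \<eta> s \<noteq> 0}"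
  then show "finite {s. \<xi> s - \<eta> s \<noteq> 0}"
    by - (rule finite_subset[of _ "{s. \<xi> s \<noteq> 0} \<union> {s. \<eta> s \<noteq> 0}"], auto)
qed
lift_definition uminus_fin_vec :: "fin_vec \<Rightarrow> fin_vec" is "\<lambda>\<xi> s. - \<xi> s" by simp
lift_definition scaleR_fin_vec :: "real \<Rightarrow> fin_vec \<Rightarrow> fin_vec" is "\<lambda>r \<xi> s. r *\<^sub>R \<xi> s"
proof -
  fix r and \<xi> :: "index_word \<Rightarrow> complex" assume "finite {s. \<xi> s \<noteq> 0}"
  then show "finite {s. r *\<^sub>R \<xi> s \<noteq> 0}" by (rule finite_subset[rotated]) auto
qed
definition inner_fin_vec :: "fin_vec \<Rightarrow> fin_vec \<Rightarrow> real" where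
  "inner_fin_vec \<xi> \<eta> = (\<Sum>s | coord \<xi> s \<noteq> 0. inner (coord \<xi> s) (coord \<eta> s))"
definition norm_fin_vec :: "fin_vec \<Rightarrow> real" where
  "norm_fin_vec \<xi> = sqrt (inner \<xi> \<xi>)"
definition dist_fin_vec :: "fin_vec \<Rightarrow> fin_vec \<Rightarrow> real" where
  "dist_fin_vec \<xi> \<eta> = norm (\<xi> - \<eta>)"
definition sgn_fin_vec :: "fin_vec \<Rightarrow> fin_vec" where
  "sgn_fin_vec \<xi> = scaleR (inverse (norm \<xi>)) \<xi>"
definition uniformity_fin_vec :: "(fin_vec \<times> fin_vec) filter" where
  "uniformity_fin_vec = (INF e\<in>{0 <..}. principal {(x, y). dist x y < e})"
definition open_fin_vec :: "fin_vec set \<Rightarrow> bool" where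
  "open_fin_vec U \<longleftrightarrow> (\<forall>x\<in>U. eventually (\<lambda>(x', y). x' = x \<longrightarrow> y \<in> U) uniformity)"

lemma inner_fin_vec_superset:
  assumes "finite F" "\<And>s. s \<notin> F \<Longrightarrow> coord \<xi> s = 0 \<or> coord \<eta> s = 0"
  shows "inner \<xi> \<eta> = (\<Sum>s\<in>F. inner (coord \<xi> s) (coord \<eta> s))"
  unfolding inner_fin_vec_def
proof (rule sum.mono_neutral_cong[OF assms(1) finite_coord])
  fix s assume "s \<in> {s. coord \<xi> s \<noteq> 0} - F"
  then show "inner (coord \<xi> s) (coord \<eta> s) = 0" using assms(2)[of s] by auto
qed auto

instance
proof
  fix x y z :: fin_vec and r s :: real and U :: "fin_vec set"
  show "x + y + z = x + (y + z)" by transfer (simp add: algebra_simps)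
  show "x + y = y + x" by transfer (simp add: algebra_simps)
  show "0 + x = x" by transfer simp
  show "- x + x = 0" by transfer simp
  show "x - y = x + - y" by transfer simp
  show "r *\<^sub>R (x + y) = r *\<^sub>R x + r *\<^sub>R y" by transfer (simp add: algebra_simps)
  show "(r + s) *\<^sub>R x = r *\<^sub>R x + s *\<^sub>R x" by transfer (simp add: algebra_simps)
  show "r *\<^sub>R s *\<^sub>R x = (r * s) *\<^sub>R x" by transfer simp
  show "1 *\<^sub>R x = x" by transfer simp
  show "dist x y = norm (x - y)" by (rule dist_fin_vec_def)
  show "sgn x = inverse (norm x) *\<^sub>R x" by (rule sgn_fin_vec_def)
  show "uniformity = (INF e\<in>{0 <..}. principal {(x, y::fin_vec). dist x y < e})"
    by (rule uniformity_fin_vec_def)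
  show "open U \<longleftrightarrow> (\<forall>x\<in>U. eventually (\<lambda>(x', y). x' = x \<longrightarrow> y \<in> U) uniformity)"
    by (rule open_fin_vec_def)
  show "norm x = sqrt (inner x x)" by (rule norm_fin_vec_def)
  let ?F = "{s. coord x s \<noteq> 0} \<union> {s. coord y s \<noteq> 0} \<union> {s. coord z s \<noteq> 0}"
  have F: "finite ?F" by (intro finite_UnI finite_coord)
  show "inner x y = inner y x"
    by (subst (1 2) inner_fin_vec_superset[OF F]) (auto simp: inner_commute)
  show "inner (x + y) z = inner x z + inner y z"
    by (subst (1 2 3) inner_fin_vec_superset[OF F])
       (auto simp: plus_fin_vec.rep_eq inner_add_left sum.distrib)
  show "inner (r *\<^sub>R x) y = r * inner x y"
    by (subst (1 2) inner_fin_vec_superset[OF F]) (auto simp: scaleR_fin_vec.rep_eq sum_distrib_left)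
  show "0 \<le> inner x x" unfolding inner_fin_vec_def by (intro sum_nonneg) simp
  show "inner x x = 0 \<longleftrightarrow> x = 0"
    unfolding inner_fin_vec_def
    by (subst sum_nonneg_eq_0_iff[OF finite_coord])
       (auto intro!: fin_vec_eqI simp: zero_fin_vec.rep_eq)
qed

end

definition amplify :: "nat \<Rightarrow> (3 list \<Rightarrow> 3 list \<Rightarrow> complex) \<Rightarrow> index_word \<Rightarrow> index_word \<Rightarrow> complex" where
  "amplify n a s t =
     (if \<forall>i\<ge>n. s i = t i then a (map s [0..<n]) (map t [0..<n]) else 0)"

typedef alg_uhf = "{K :: index_word \<Rightarrow> index_word \<Rightarrow> complex. \<exists>n a. K = amplify n a}"
  morphisms entry Abs_alg_uhf
  by blast

setup_lifting type_definition_alg_uhf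

definition is_local :: "nat \<Rightarrow> (index_word \<Rightarrow> index_word \<Rightarrow> complex) \<Rightarrow> bool" where
  "is_local n K \<longleftrightarrow> (\<forall>s t. K s t \<noteq> 0 \<longrightarrow> (\<forall>i\<ge>n. s i = t i)) \<and>
     (\<forall>s t s' t'. (\<forall>i\<ge>n. s i = t i \<and> s' i = t' i) \<longrightarrow>
        (\<forall>i<n. s i = s' i \<and> t i = t' i) \<longrightarrow> K s t = K s' t')"

lemma is_localD: "is_local n K \<Longrightarrow> K s t \<noteq> 0 \<Longrightarrow> i \<ge> n \<Longrightarrow> s i = t i"
  unfolding is_local_def by blast

lemma is_local_cong:
  assumes "is_local n K" "\<And>i. i \<ge> n \<Longrightarrow> s i = t i" "\<And>i. i \<ge> n \<Longrightarrow> s' i = t' i"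
    "\<And>i. i < n \<Longrightarrow> s i = s' i" "\<And>i. i < n \<Longrightarrow> t i = t' i"
  shows "K s t = K s' t'"
  using assms unfolding is_local_def by blast

lemma is_local_iff: "is_local n K \<longleftrightarrow> (\<exists>a. K = amplify n a)"
proof
  assume K: "is_local n K"
  let ?w = "\<lambda>(v::3 list) i. if i < n then v ! i else 0"
  have "K s t = amplify n (\<lambda>v w. K (?w v) (?w w)) s t" for s t
  proof (cases "\<forall>i\<ge>n. s i = t i")
    case True
    show ?thesis
      unfolding amplify_def if_P[OF True]
      by (rule is_local_cong[OF K]) (use True in auto)
  next
    case False
    then have "K s t = 0" using is_localD[OF K] by blast
    with False show ?thesis by (auto simp: amplify_def)
  qed
  then show "\<exists>a. K = amplify n a" by blast
next
  assume "\<exists>a. K = amplify n a"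
  then obtain a where K: "K = amplify n a" by blast
  have *: "K s t = K s' t'" if "\<forall>i\<ge>n. s i = t i \<and> s' i = t' i" "\<forall>i<n. s i = s' i \<and> t i = t' i" for s t s' t'
  proof -
    have "map s [0..<n] = map s' [0..<n]" "map t [0..<n] = map t' [0..<n]" using that by auto
    then show ?thesis using that unfolding K amplify_def by (metis (no_types, lifting))
  qed
  have "s i = t i" if "K s t \<noteq> 0" "n \<le> i" for s t i
    using that unfolding K amplify_def by (metis (no_types, lifting))
  with * show "is_local n K" unfolding is_local_def by blast
qed

lemma is_local_mono:
  assumes K: "is_local n K" and "n \<le> m" shows "is_local m K"
  unfolding is_local_def
proof (intro conjI allI impI)
  fix s t and i assume "K s t \<noteq> 0" "m \<le> i"
  then show "s i = t i" using is_localD[OF K] \<open>n \<le> m\<close> by auto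
next
  fix s t s' t' :: index_word
  assume 1: "\<forall>i\<ge>m. s i = t i \<and> s' i = t' i" and 2: "\<forall>i<m. s i = s' i \<and> t i = t' i"
  show "K s t = K s' t'"
  proof (cases "\<forall>i\<ge>n. s i = t i")
    case True
    then have "\<forall>i\<ge>n. s' i = t' i" using 1 2 by (metis not_le)
    then show ?thesis
      using True 2 \<open>n \<le> m\<close> by (intro is_local_cong[OF K]) auto
  next
    case False
    then obtain i where i: "i \<ge> n" "s i \<noteq> t i" by blast
    then have "i < m" using 1 by (metis not_le)
    then have "s' i \<noteq> t' i" using 2 i by metis
    then have "K s t = 0" "K s' t' = 0" using i is_localD[OF K] by blast+
    then show ?thesis by simp
  qed
qed

lemma is_local_entry: obtains n where "is_local n (entry x)"
  using entry[of x] is_local_iff by auto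

lemma is_local_entry2: obtains n where "is_local n (entry x)" "is_local n (entry y)"
proof -
  obtain n m where "is_local n (entry x)" "is_local m (entry y)" by (meson is_local_entry)
  then show ?thesis using that[of "max n m"] is_local_mono by (meson max.cobounded1 max.cobounded2)
qed

lemma is_local_entry3: obtains n where "is_local n (entry x)" "is_local n (entry y)" "is_local n (entry z)"
proof -
  obtain n m where "is_local n (entry x)" "is_local n (entry y)" "is_local m (entry z)"
    by (meson is_local_entry is_local_entry2)
  then show ?thesis using that[of "max n m"] is_local_mono by (meson max.cobounded1 max.cobounded2)
qed

definition tail_class :: "nat \<Rightarrow> index_word \<Rightarrow> index_word set" where
  "tail_class n s = {t. \<forall>i\<ge>n. t i = s i}"

lemma finite_tail_class: "finite (tail_class n s)"
  and card_tail_class: "card (tail_class n s) \<le> 3 ^ n"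
proof -
  let ?L = "{v::3 list. length v = n}"
  have fin: "finite ?L" and card: "card ?L = 3 ^ n"
    using finite_lists_length_eq[of "UNIV :: 3 set" n] card_lists_length_eq[of "UNIV :: 3 set" n] by simp_all
  have sub: "tail_class n s \<subseteq> (\<lambda>v i. if i < n then v ! i else s i) ` ?L"
  proof
    fix t assume "t \<in> tail_class n s"
    then have "t = (\<lambda>i. if i < n then map t [0..<n] ! i else s i)"
      by (auto simp: tail_class_def fun_eq_iff)
    then show "t \<in> (\<lambda>v i. if i < n then v ! i else s i) ` ?L" by (rule image_eqI) simp
  qed
  show "finite (tail_class n s)" by (rule finite_subset[OF sub]) (simp add: fin)
  show "card (tail_class n s) \<le> 3 ^ n"
    using card_mono[OF finite_imageI[OF fin] sub] card_image_le[OF fin, of "\<lambda>v i. if i < n then v ! i else s i"]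
    by (simp add: card)
qed

lemma real_card_tail_class: "real (card (tail_class n s)) \<le> 3 ^ n"
  using card_tail_class[of n s] of_nat_le_iff[of "card (tail_class n s)" "3 ^ n", where 'a=real] by simp

lemma tail_class_sym: "t \<in> tail_class n s \<longleftrightarrow> s \<in> tail_class n t"
  by (auto simp: tail_class_def)

lemma tail_class_eq: "t \<in> tail_class n s \<Longrightarrow> tail_class n t = tail_class n s"
  by (auto simp: tail_class_def)

lemma is_local_tail: "is_local n K \<Longrightarrow> t \<notin> tail_class n s \<Longrightarrow> K s t = 0"
  unfolding tail_class_def using is_localD by fastforce

definition mat_mult :: "(index_word \<Rightarrow> index_word \<Rightarrow> complex) \<Rightarrow> (index_word \<Rightarrow> index_word \<Rightarrow> complex) \<Rightarrow> index_word \<Rightarrow> index_word \<Rightarrow> complex" where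
  "mat_mult K L s t = (\<Sum>u | K s u \<noteq> 0. K s u * L u t)"

lemma mat_mult_tail:
  assumes "is_local n K"
  shows "mat_mult K L s t = (\<Sum>u\<in>tail_class n s. K s u * L u t)"
  unfolding mat_mult_def
  by (rule sum.mono_neutral_left[OF finite_tail_class]) (use is_local_tail[OF assms] in auto)

lemma is_local_mult:
  assumes K: "is_local n K" and L: "is_local n L" shows "is_local n (mat_mult K L)"
  unfolding is_local_def
proof (intro conjI allI impI)
  fix s t i assume *: "mat_mult K L s t \<noteq> 0" and "n \<le> i"
  then obtain u where "K s u \<noteq> 0" "L u t \<noteq> 0"
    unfolding mat_mult_def by (elim sum.not_neutral_contains_not_neutral) auto
  then show "s i = t i" using \<open>n \<le> i\<close> is_localD[OF K] is_localD[OF L] by metis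
next
  fix s t s' t' :: index_word
  assume 1: "\<forall>i\<ge>n. s i = t i \<and> s' i = t' i" and 2: "\<forall>i<n. s i = s' i \<and> t i = t' i"
  let ?g = "\<lambda>s u i. if i < n then u i else s i"
  show "mat_mult K L s t = mat_mult K L s' t'"
    unfolding mat_mult_tail[OF K]
  proof (rule sum.reindex_bij_witness[of _ "?g s" "?g s'"])
    fix u assume u: "u \<in> tail_class n s"
    show "?g s (?g s' u) = u" "?g s' u \<in> tail_class n s'"
      using u by (auto simp: tail_class_def fun_eq_iff)
    have "K s' (?g s' u) = K s u"
      using u 1 2 by (intro is_local_cong[OF K]) (auto simp: tail_class_def)
    moreover have "L (?g s' u) t' = L u t"
      using u 1 2 by (intro is_local_cong[OF L]) (auto simp: tail_class_def)
    ultimately show "K s' (?g s' u) * L (?g s' u) t' = K s u * L u t" by simp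
  next
    fix u assume u: "u \<in> tail_class n s'"
    show "?g s' (?g s u) = u" "?g s u \<in> tail_class n s"
      using u by (auto simp: tail_class_def fun_eq_iff)
  qed
qed

definition mat_apply :: "(index_word \<Rightarrow> index_word \<Rightarrow> complex) \<Rightarrow> (index_word \<Rightarrow> complex) \<Rightarrow> index_word \<Rightarrow> complex" where
  "mat_apply K \<xi> s = (\<Sum>t | \<xi> t \<noteq> 0. K s t * \<xi> t)"

lift_definition alg_uhf_apply :: "alg_uhf \<Rightarrow> fin_vec \<Rightarrow> fin_vec" is mat_apply
proof -
  fix K and \<xi> :: "index_word \<Rightarrow> complex" assume "\<exists>n a. K = amplify n a" and fin: "finite {s. \<xi> s \<noteq> 0}"
  then obtain n where K: "is_local n K" by (auto simp: is_local_iff)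
  have "{s. mat_apply K \<xi> s \<noteq> 0} \<subseteq> (\<Union>t\<in>{t. \<xi> t \<noteq> 0}. tail_class n t)"
  proof
    fix s assume "s \<in> {s. mat_apply K \<xi> s \<noteq> 0}"
    then obtain t where "\<xi> t \<noteq> 0" "K s t \<noteq> 0"
      unfolding mat_apply_def mem_Collect_eq by (elim sum.not_neutral_contains_not_neutral) auto
    then show "s \<in> (\<Union>t\<in>{t. \<xi> t \<noteq> 0}. tail_class n t)"
      using is_local_tail[OF K] tail_class_sym by blast
  qed
  then show "finite {s. mat_apply K \<xi> s \<noteq> 0}"
    by (rule finite_subset) (simp add: fin finite_tail_class)
qed

lemma coord_apply_superset:
  assumes "finite F" "\<And>t. t \<notin> F \<Longrightarrow> entry x s t = 0 \<or> coord \<xi> t = 0"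
  shows "coord (alg_uhf_apply x \<xi>) s = (\<Sum>t\<in>F. entry x s t * coord \<xi> t)"
  unfolding alg_uhf_apply.rep_eq mat_apply_def
proof (rule sum.mono_neutral_cong[OF assms(1) finite_coord])
  fix t assume "t \<in> F - {t. coord \<xi> t \<noteq> 0}"
  then show "entry x s t * coord \<xi> t = 0" by auto
next
  fix t assume "t \<in> {t. coord \<xi> t \<noteq> 0} - F"
  then show "entry x s t * coord \<xi> t = 0" using assms(2)[of t] by auto
qed auto

lift_definition basis_vec :: "index_word \<Rightarrow> fin_vec" is "\<lambda>s t. if t = s then 1 else 0" by simp

lemma coord_apply_basis: "coord (alg_uhf_apply x (basis_vec t)) s = entry x s t"
  by (subst coord_apply_superset[of "{t}"]) (auto simp: basis_vec.rep_eq)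

lemma norm_basis_vec: "norm (basis_vec s) = 1"
  unfolding norm_fin_vec_def
  by (subst inner_fin_vec_superset[of "{s}"]) (auto simp: basis_vec.rep_eq)

lemma bounded_linear_apply: "bounded_linear (alg_uhf_apply x)"
proof -
  obtain n where n: "is_local n (entry x)" by (rule is_local_entry)
  then obtain a where a: "entry x = amplify n a" by (auto simp: is_local_iff)
  let ?L = "{v::3 list. length v = n}"
  have fin: "finite ?L" using finite_lists_length_eq[of "UNIV :: 3 set" n] by simp
  define C where "C = (\<Sum>v\<in>?L. \<Sum>w\<in>?L. cmod (a v w))"
  have C: "cmod (entry x s t) \<le> C" for s t
  proof -
    have "cmod (a v w) \<le> C" if "v \<in> ?L" "w \<in> ?L" for v w
    proof -
      have "cmod (a v w) \<le> (\<Sum>w\<in>?L. cmod (a v w))"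
        by (rule member_le_sum[OF that(2)]) (use fin in auto)
      also have "\<dots> \<le> C"
        unfolding C_def by (rule member_le_sum[OF that(1)]) (use fin in \<open>auto intro: sum_nonneg\<close>)
      finally show ?thesis .
    qed
    moreover have "0 \<le> C" unfolding C_def by (intro sum_nonneg) simp
    ultimately show ?thesis by (simp add: a amplify_def)
  qed
  have C0: "0 \<le> C" using C[of undefined undefined] norm_ge_zero order_trans by blast
  let ?N = "3 ^ n :: real"
  have ap: "coord (alg_uhf_apply x \<xi>) s = (\<Sum>t\<in>tail_class n s. entry x s t * coord \<xi> t)" for \<xi> s
    using is_local_tail[OF n] by (intro coord_apply_superset finite_tail_class) blast
  have nrm: "(norm (alg_uhf_apply x \<xi>))\<^sup>2 \<le> (C * ?N)\<^sup>2 * (norm \<xi>)\<^sup>2" for \<xi>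
  proof -
    define F where "F = (\<Union>t\<in>{t. coord \<xi> t \<noteq> 0}. tail_class n t)"
    have F: "finite F" unfolding F_def using finite_coord finite_tail_class by blast
    have cl: "tail_class n s \<subseteq> F" if "s \<in> F" for s
      using that unfolding F_def using tail_class_eq by blast
    have supp: "coord \<xi> s = 0" if "s \<notin> F" for s
      using that unfolding F_def tail_class_def by blast
    have out: "coord (alg_uhf_apply x \<xi>) s = 0" if "s \<notin> F" for s
      unfolding ap
    proof (rule sum.neutral, rule ballI)
      fix t assume "t \<in> tail_class n s"
      then have "t \<notin> F" using that cl tail_class_sym by blast
      then show "entry x s t * coord \<xi> t = 0" by (simp add: supp)
    qed
    have pt: "(cmod (coord (alg_uhf_apply x \<xi>) s))\<^sup>2 \<le> C\<^sup>2 * ?N * (\<Sum>t\<in>tail_class n s. (cmod (coord \<xi> t))\<^sup>2)" for s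
    proof -
      have "cmod (coord (alg_uhf_apply x \<xi>) s) \<le> (\<Sum>t\<in>tail_class n s. C * cmod (coord \<xi> t))"
        unfolding ap by (rule sum_norm_le) (simp add: norm_mult C mult_right_mono)
      also have "\<dots> = C * (\<Sum>t\<in>tail_class n s. cmod (coord \<xi> t))" by (simp add: sum_distrib_left)
      finally have "(cmod (coord (alg_uhf_apply x \<xi>) s))\<^sup>2 \<le> C\<^sup>2 * (\<Sum>t\<in>tail_class n s. cmod (coord \<xi> t))\<^sup>2"
        using power_mono[of _ _ 2] by (fastforce simp: power_mult_distrib)
      also have "(\<Sum>t\<in>tail_class n s. cmod (coord \<xi> t))\<^sup>2
          \<le> real (card (tail_class n s)) * (\<Sum>t\<in>tail_class n s. (cmod (coord \<xi> t))\<^sup>2)"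
        using Cauchy_Schwarz_ineq_sum[of "\<lambda>t. 1" "\<lambda>t. cmod (coord \<xi> t)" "tail_class n s"] by simp
      also have "\<dots> \<le> ?N * (\<Sum>t\<in>tail_class n s. (cmod (coord \<xi> t))\<^sup>2)"
        by (intro mult_right_mono sum_nonneg real_card_tail_class) simp
      finally show ?thesis by (simp add: mult_left_mono mult.assoc)
    qed
    have "(norm (alg_uhf_apply x \<xi>))\<^sup>2 = (\<Sum>s\<in>F. (cmod (coord (alg_uhf_apply x \<xi>) s))\<^sup>2)"
      unfolding power2_norm_eq_inner by (intro inner_fin_vec_superset F) (simp add: out)
    also have "\<dots> \<le> (\<Sum>s\<in>F. C\<^sup>2 * ?N * (\<Sum>t\<in>tail_class n s. (cmod (coord \<xi> t))\<^sup>2))"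
      by (intro sum_mono pt)
    also have "\<dots> = C\<^sup>2 * ?N * (\<Sum>s\<in>F. \<Sum>t\<in>F. if t \<in> tail_class n s then (cmod (coord \<xi> t))\<^sup>2 else 0)"
    proof -
      have "(\<Sum>t\<in>tail_class n s. (cmod (coord \<xi> t))\<^sup>2) =
          (\<Sum>t\<in>F. if t \<in> tail_class n s then (cmod (coord \<xi> t))\<^sup>2 else 0)" if "s \<in> F" for s
        using cl[OF that] by (intro sum.mono_neutral_cong_left F) auto
      then show ?thesis by (simp add: sum_distrib_left)
    qed
    also have "\<dots> = C\<^sup>2 * ?N * (\<Sum>t\<in>F. \<Sum>s\<in>F. if s \<in> tail_class n t then (cmod (coord \<xi> t))\<^sup>2 else 0)"
      by (subst sum.swap) (simp add: tail_class_sym[of _ n])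
    also have "\<dots> \<le> C\<^sup>2 * ?N * (\<Sum>t\<in>F. ?N * (cmod (coord \<xi> t))\<^sup>2)"
    proof (intro mult_left_mono sum_mono)
      fix t assume t: "t \<in> F"
      have "(\<Sum>s\<in>F. if s \<in> tail_class n t then (cmod (coord \<xi> t))\<^sup>2 else 0)
          = (\<Sum>s\<in>tail_class n t. (cmod (coord \<xi> t))\<^sup>2)"
        using cl[OF t] by (intro sum.mono_neutral_cong_right F) auto
      also have "\<dots> \<le> ?N * (cmod (coord \<xi> t))\<^sup>2"
        by (auto intro!: mult_right_mono real_card_tail_class)
      finally show "(\<Sum>s\<in>F. if s \<in> tail_class n t then (cmod (coord \<xi> t))\<^sup>2 else 0)
          \<le> ?N * (cmod (coord \<xi> t))\<^sup>2" .
    qed simp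
    also have "\<dots> = (C * ?N)\<^sup>2 * (\<Sum>t\<in>F. (cmod (coord \<xi> t))\<^sup>2)"
      by (simp add: power2_eq_square flip: sum_distrib_left)
    also have "(\<Sum>t\<in>F. (cmod (coord \<xi> t))\<^sup>2) = (norm \<xi>)\<^sup>2"
      unfolding power2_norm_eq_inner
      by (rule inner_fin_vec_superset[symmetric]) (simp_all add: F supp)
    finally show ?thesis .
  qed
  show ?thesis
  proof (rule bounded_linear_intro[of _ "C * ?N"])
    show "alg_uhf_apply x (\<xi> + \<eta>) = alg_uhf_apply x \<xi> + alg_uhf_apply x \<eta>" for \<xi> \<eta>
      by (rule fin_vec_eqI) (simp add: ap plus_fin_vec.rep_eq algebra_simps sum.distrib)
    show "alg_uhf_apply x (r *\<^sub>R \<xi>) = r *\<^sub>R alg_uhf_apply x \<xi>" for r \<xi>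
      by (rule fin_vec_eqI) (simp add: ap scaleR_fin_vec.rep_eq scaleR_sum_right)
    show "norm (alg_uhf_apply x \<xi>) \<le> norm \<xi> * (C * ?N)" for \<xi>
    proof (rule power2_le_imp_le)
      show "(norm (alg_uhf_apply x \<xi>))\<^sup>2 \<le> (norm \<xi> * (C * ?N))\<^sup>2"
        unfolding power_mult_distrib[of "norm \<xi>"] using nrm[of \<xi>] by (simp only: mult.commute)
      show "0 \<le> norm \<xi> * (C * ?N)" using C0 by simp
    qed
  qed
qed

instantiation alg_uhf :: pre_cstar_algebra
begin

lift_definition zero_alg_uhf :: alg_uhf is "\<lambda>s t. 0"
  by (rule exI[of _ 0], rule exI[of _ "\<lambda>v w. 0"]) (simp add: amplify_def fun_eq_iff)
lift_definition one_alg_uhf :: alg_uhf is "\<lambda>s t. if s = t then 1 else 0"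
  by (rule exI[of _ 0], rule exI[of _ "\<lambda>v w. 1"]) (auto simp: amplify_def fun_eq_iff)
lift_definition plus_alg_uhf :: "alg_uhf \<Rightarrow> alg_uhf \<Rightarrow> alg_uhf" is "\<lambda>K L s t. K s t + L s t"
proof -
  fix K L assume "\<exists>n a. K = amplify n a" "\<exists>n a. L = amplify n a"
  then obtain n m where "is_local n K" "is_local m L" by (auto simp: is_local_iff)
  then have 1: "is_local (max n m) K" and 2: "is_local (max n m) L"
    by (simp_all add: is_local_mono[OF _ max.cobounded1] is_local_mono[OF _ max.cobounded2])
  obtain a b where "K = amplify (max n m) a" "L = amplify (max n m) b"
    using 1 2 by (auto simp: is_local_iff)
  then have "(\<lambda>s t. K s t + L s t) = amplify (max n m) (\<lambda>v w. a v w + b v w)"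
    by (auto simp: amplify_def fun_eq_iff)
  then show "\<exists>n a. (\<lambda>s t. K s t + L s t) = amplify n a" by blast
qed
lift_definition uminus_alg_uhf :: "alg_uhf \<Rightarrow> alg_uhf" is "\<lambda>K s t. - K s t"
proof (elim exE)
  fix K n a assume "K = amplify n a"
  then have "(\<lambda>s t. - K s t) = amplify n (\<lambda>v w. - a v w)" by (auto simp: amplify_def fun_eq_iff)
  then show "\<exists>n a. (\<lambda>s t. - K s t) = amplify n a" by blast
qed
definition minus_alg_uhf :: "alg_uhf \<Rightarrow> alg_uhf \<Rightarrow> alg_uhf" where "minus_alg_uhf x y = x + - y"
lift_definition times_alg_uhf :: "alg_uhf \<Rightarrow> alg_uhf \<Rightarrow> alg_uhf" is mat_mult
proof -
  fix K L assume "\<exists>n a. K = amplify n a" "\<exists>n a. L = amplify n a"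
  then obtain n m where "is_local n K" "is_local m L" by (auto simp: is_local_iff)
  then have 1: "is_local (max n m) K" and 2: "is_local (max n m) L"
    by (simp_all add: is_local_mono[OF _ max.cobounded1] is_local_mono[OF _ max.cobounded2])
  show "\<exists>n a. mat_mult K L = amplify n a"
    using is_local_mult[OF 1 2] unfolding is_local_iff by blast
qed
lift_definition scaleC_alg_uhf :: "complex \<Rightarrow> alg_uhf \<Rightarrow> alg_uhf" is "\<lambda>c K s t. c * K s t"
proof (elim exE)
  fix c K n a assume "K = amplify n a"
  then have "(\<lambda>s t. c * K s t) = amplify n (\<lambda>v w. c * a v w)" by (auto simp: amplify_def fun_eq_iff)
  then show "\<exists>n a. (\<lambda>s t. c * K s t) = amplify n a" by blast
qed
definition scaleR_alg_uhf :: "real \<Rightarrow> alg_uhf \<Rightarrow> alg_uhf" where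
  "scaleR_alg_uhf r x = scaleC (complex_of_real r) x"
lift_definition adj_alg_uhf :: "alg_uhf \<Rightarrow> alg_uhf" is "\<lambda>K s t. cnj (K t s)"
proof (elim exE)
  fix K n a assume "K = amplify n a"
  then have "(\<lambda>s t. cnj (K t s)) = amplify n (\<lambda>v w. cnj (a w v))" by (auto simp: amplify_def fun_eq_iff)
  then show "\<exists>n a. (\<lambda>s t. cnj (K t s)) = amplify n a" by blast
qed
definition norm_alg_uhf :: "alg_uhf \<Rightarrow> real" where "norm_alg_uhf x = onorm (alg_uhf_apply x)"
definition dist_alg_uhf :: "alg_uhf \<Rightarrow> alg_uhf \<Rightarrow> real" where "dist_alg_uhf x y = norm (x - y)"
definition sgn_alg_uhf :: "alg_uhf \<Rightarrow> alg_uhf" where "sgn_alg_uhf x = scaleR (inverse (norm x)) x"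
definition uniformity_alg_uhf :: "(alg_uhf \<times> alg_uhf) filter" where
  "uniformity_alg_uhf = (INF e\<in>{0 <..}. principal {(x, y). dist x y < e})"
definition open_alg_uhf :: "alg_uhf set \<Rightarrow> bool" where
  "open_alg_uhf U \<longleftrightarrow> (\<forall>x\<in>U. eventually (\<lambda>(x', y). x' = x \<longrightarrow> y \<in> U) uniformity)"

lemma alg_uhf_eqI: "(\<And>s t. entry x s t = entry y s t) \<Longrightarrow> x = y"
  by (simp add: entry_inject[symmetric] fun_eq_iff)

lemma entry_mult_tail:
  assumes "is_local n (entry x)"
  shows "entry (x * y) s t = (\<Sum>u\<in>tail_class n s. entry x s u * entry y u t)"
  unfolding times_alg_uhf.rep_eq by (rule mat_mult_tail[OF assms])

lemma entry_mult_tail':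
  assumes "is_local n (entry y)"
  shows "entry (x * y) s t = (\<Sum>u\<in>tail_class n t. entry x s u * entry y u t)"
proof -
  obtain m where m: "is_local m (entry x)" by (rule is_local_entry)
  have fin: "finite {u. entry x s u \<noteq> 0}"
    by (rule finite_subset[OF _ finite_tail_class[of m s]]) (use is_local_tail[OF m] in blast)
  show ?thesis
    unfolding times_alg_uhf.rep_eq mat_mult_def
  proof (rule sum.mono_neutral_cong[OF finite_tail_class fin])
    fix u assume "u \<in> tail_class n t - {u. entry x s u \<noteq> 0}"
    then show "entry x s u * entry y u t = 0" by auto
  next
    fix u assume "u \<in> {u. entry x s u \<noteq> 0} - tail_class n t"
    then have "t \<notin> tail_class n u" by (simp add: tail_class_sym)
    then show "entry x s u * entry y u t = 0" using is_local_tail[OF assms] by simp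
  qed simp
qed

lemma apply_mult: "alg_uhf_apply (x * y) \<xi> = alg_uhf_apply x (alg_uhf_apply y \<xi>)"
proof (rule fin_vec_eqI)
  fix s
  obtain n where n: "is_local n (entry x)" by (rule is_local_entry)
  let ?F = "{s. coord \<xi> s \<noteq> 0}"
  have y: "coord (alg_uhf_apply y \<xi>) u = (\<Sum>t\<in>?F. entry y u t * coord \<xi> t)" for u
    by (intro coord_apply_superset finite_coord) simp
  have "coord (alg_uhf_apply (x * y) \<xi>) s = (\<Sum>t\<in>?F. entry (x * y) s t * coord \<xi> t)"
    by (intro coord_apply_superset finite_coord) simp
  also have "\<dots> = (\<Sum>t\<in>?F. \<Sum>u\<in>tail_class n s. entry x s u * entry y u t * coord \<xi> t)"
    by (simp add: entry_mult_tail[OF n] sum_distrib_right)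
  also have "\<dots> = (\<Sum>u\<in>tail_class n s. \<Sum>t\<in>?F. entry x s u * entry y u t * coord \<xi> t)"
    by (rule sum.swap)
  also have "\<dots> = (\<Sum>u\<in>tail_class n s. entry x s u * coord (alg_uhf_apply y \<xi>) u)"
    by (simp add: y sum_distrib_left mult.assoc)
  also have "\<dots> = coord (alg_uhf_apply x (alg_uhf_apply y \<xi>)) s"
    using is_local_tail[OF n] by (intro coord_apply_superset[symmetric] finite_tail_class) blast
  finally show "coord (alg_uhf_apply (x * y) \<xi>) s = coord (alg_uhf_apply x (alg_uhf_apply y \<xi>)) s" .
qed

lemma coord_apply_support:
  "coord (alg_uhf_apply x \<xi>) s = (\<Sum>t | coord \<xi> t \<noteq> 0. entry x s t * coord \<xi> t)"
  by (intro coord_apply_superset finite_coord) simp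

lemma apply_add: "alg_uhf_apply (x + y) \<xi> = alg_uhf_apply x \<xi> + alg_uhf_apply y \<xi>"
  by (rule fin_vec_eqI)
     (simp add: coord_apply_support plus_fin_vec.rep_eq plus_alg_uhf.rep_eq algebra_simps sum.distrib)

lemma apply_scaleR: "alg_uhf_apply (r *\<^sub>R x) \<xi> = r *\<^sub>R alg_uhf_apply x \<xi>"
  by (rule fin_vec_eqI)
     (simp add: coord_apply_support scaleR_fin_vec.rep_eq scaleR_alg_uhf_def scaleC_alg_uhf.rep_eq
       scaleR_conv_of_real sum_distrib_left mult.assoc)

lemma apply_one: "alg_uhf_apply 1 \<xi> = \<xi>"
  by (rule fin_vec_eqI, subst coord_apply_superset[of "{s}" for s]) (auto simp: one_alg_uhf.rep_eq)

lemma inner_apply: "inner (alg_uhf_apply x \<xi>) \<eta> = inner \<xi> (alg_uhf_apply (adj x) \<eta>)"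
proof -
  let ?F = "{s. coord \<xi> s \<noteq> 0}" and ?G = "{s. coord \<eta> s \<noteq> 0}"
  have mv: "inner (a * b) c = inner b (cnj a * c)" for a b c :: complex
    by (simp add: inner_complex_def algebra_simps)
  have "inner (alg_uhf_apply x \<xi>) \<eta> = (\<Sum>s\<in>?G. inner (coord (alg_uhf_apply x \<xi>) s) (coord \<eta> s))"
    by (intro inner_fin_vec_superset finite_coord) simp
  also have "\<dots> = (\<Sum>s\<in>?G. \<Sum>t\<in>?F. inner (coord \<xi> t) (cnj (entry x s t) * coord \<eta> s))"
    by (simp add: coord_apply_support inner_sum_left mv)
  also have "\<dots> = (\<Sum>t\<in>?F. \<Sum>s\<in>?G. inner (coord \<xi> t) (cnj (entry x s t) * coord \<eta> s))"
    by (rule sum.swap)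
  also have "\<dots> = (\<Sum>t\<in>?F. inner (coord \<xi> t) (coord (alg_uhf_apply (adj x) \<eta>) t))"
    by (simp add: coord_apply_support inner_sum_right adj_alg_uhf.rep_eq)
  also have "\<dots> = inner \<xi> (alg_uhf_apply (adj x) \<eta>)"
    by (rule inner_fin_vec_def[symmetric])
  finally show ?thesis .
qed

lemma norm_apply_le: "norm (alg_uhf_apply x \<xi>) \<le> norm x * norm \<xi>"
  unfolding norm_alg_uhf_def by (rule onorm[OF bounded_linear_apply])

lemma norm_alg_uhf_le:
  "0 \<le> b \<Longrightarrow> (\<And>\<xi>. norm (alg_uhf_apply x \<xi>) \<le> b * norm \<xi>) \<Longrightarrow> norm x \<le> b"
  unfolding norm_alg_uhf_def by (rule onorm_bound)

instance
proof
  fix a b c :: alg_uhf and k l :: complex and r s :: real and U :: "alg_uhf set"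
  have pos: "0 \<le> norm x" for x :: alg_uhf
    unfolding norm_alg_uhf_def by (rule onorm_pos_le[OF bounded_linear_apply])
  show "a + b + c = a + (b + c)" by transfer (simp add: algebra_simps)
  show "a + b = b + a" by transfer (simp add: algebra_simps)
  show "0 + a = a" by transfer simp
  show "- a + a = 0" by transfer simp
  show "a - b = a + - b" by (rule minus_alg_uhf_def)
  show "r *\<^sub>R (a + b) = r *\<^sub>R a + r *\<^sub>R b" unfolding scaleR_alg_uhf_def by transfer (simp add: algebra_simps)
  show "(r + s) *\<^sub>R a = r *\<^sub>R a + s *\<^sub>R a" unfolding scaleR_alg_uhf_def by transfer (simp add: algebra_simps)
  show "r *\<^sub>R s *\<^sub>R a = (r * s) *\<^sub>R a" unfolding scaleR_alg_uhf_def by transfer (simp add: algebra_simps)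
  show "1 *\<^sub>R a = a" unfolding scaleR_alg_uhf_def by transfer simp
  show "a * b * c = a * (b * c)"
  proof (rule alg_uhf_eqI)
    fix s t
    obtain n where n: "is_local n (entry a)" "is_local n (entry c)" by (rule is_local_entry2)
    have "entry (a * b * c) s t = (\<Sum>v\<in>tail_class n t. \<Sum>u\<in>tail_class n s. entry a s u * entry b u v * entry c v t)"
      by (simp add: entry_mult_tail'[OF n(2)] entry_mult_tail[OF n(1)] sum_distrib_right)
    also have "\<dots> = (\<Sum>u\<in>tail_class n s. \<Sum>v\<in>tail_class n t. entry a s u * entry b u v * entry c v t)"
      by (rule sum.swap)
    also have "\<dots> = entry (a * (b * c)) s t"
      by (simp add: entry_mult_tail'[OF n(2)] entry_mult_tail[OF n(1)] sum_distrib_left mult.assoc)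
    finally show "entry (a * b * c) s t = entry (a * (b * c)) s t" .
  qed
  obtain n where n: "is_local n (entry a)" "is_local n (entry b)" "is_local n (entry c)"
    by (rule is_local_entry3)
  note E = entry_mult_tail[OF n(1)] entry_mult_tail[OF n(2)]
  note E' = entry_mult_tail'[OF n(2)] entry_mult_tail'[OF n(3)]
  show "(a + b) * c = a * c + b * c"
    by (rule alg_uhf_eqI) (simp add: E' plus_alg_uhf.rep_eq distrib_right sum.distrib)
  show "a * (b + c) = a * b + a * c"
    by (rule alg_uhf_eqI) (simp add: E plus_alg_uhf.rep_eq distrib_left sum.distrib)
  show k1: "(k *\<^sub>C a) * b = k *\<^sub>C (a * b)" for k
    by (rule alg_uhf_eqI) (simp add: E' scaleC_alg_uhf.rep_eq mult.assoc sum_distrib_left)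
  show k2: "a * (k *\<^sub>C b) = k *\<^sub>C (a * b)" for k
    by (rule alg_uhf_eqI) (simp add: E scaleC_alg_uhf.rep_eq mult.left_commute sum_distrib_left)
  show "r *\<^sub>R a * b = r *\<^sub>R (a * b)" unfolding scaleR_alg_uhf_def by (rule k1)
  show "a * r *\<^sub>R b = r *\<^sub>R (a * b)" unfolding scaleR_alg_uhf_def by (rule k2)
  show "1 * a = a"
    by (rule alg_uhf_eqI) (simp add: times_alg_uhf.rep_eq mat_mult_def one_alg_uhf.rep_eq)
  show "a * 1 = a"
  proof (rule alg_uhf_eqI)
    fix s t
    have "entry (a * 1) s t = (\<Sum>u\<in>tail_class n s. if u = t then entry a s u else 0)"
      unfolding entry_mult_tail[OF n(1)] by (intro sum.cong) (auto simp: one_alg_uhf.rep_eq)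
    also have "\<dots> = entry a s t"
      using is_local_tail[OF n(1)] by (simp add: finite_tail_class)
    finally show "entry (a * 1) s t = entry a s t" .
  qed
  show "(0::alg_uhf) \<noteq> 1" by transfer (auto simp: fun_eq_iff)
  show "dist a b = norm (a - b)" by (rule dist_alg_uhf_def)
  show "sgn a = inverse (norm a) *\<^sub>R a" by (rule sgn_alg_uhf_def)
  show "uniformity = (INF e\<in>{0 <..}. principal {(x, y::alg_uhf). dist x y < e})"
    by (rule uniformity_alg_uhf_def)
  show "open U \<longleftrightarrow> (\<forall>x\<in>U. eventually (\<lambda>(x', y). x' = x \<longrightarrow> y \<in> U) uniformity)"
    by (rule open_alg_uhf_def)
  show "norm a = 0 \<longleftrightarrow> a = 0"
  proof
    assume "norm a = 0"
    then have "alg_uhf_apply a \<xi> = 0" for \<xi> using norm_apply_le[of a \<xi>] by simp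
    then show "a = 0"
      by (intro alg_uhf_eqI) (simp add: zero_alg_uhf.rep_eq zero_fin_vec.rep_eq flip: coord_apply_basis)
  next
    assume "a = 0"
    then have "alg_uhf_apply a \<xi> = 0" for \<xi>
      by (intro fin_vec_eqI) (simp add: coord_apply_support zero_alg_uhf.rep_eq zero_fin_vec.rep_eq)
    then show "norm a = 0" using norm_alg_uhf_le[of 0 a] pos[of a] by simp
  qed
  show "norm (a + b) \<le> norm a + norm b"
    by (intro norm_alg_uhf_le add_nonneg_nonneg pos)
       (auto simp: apply_add distrib_right intro: norm_triangle_le add_mono norm_apply_le)
  show "norm (a * b) \<le> norm a * norm b"
  proof (intro norm_alg_uhf_le mult_nonneg_nonneg pos)
    fix \<xi>
    have "norm (alg_uhf_apply a (alg_uhf_apply b \<xi>)) \<le> norm a * (norm b * norm \<xi>)"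
      by (rule order_trans[OF norm_apply_le mult_left_mono[OF norm_apply_le pos]])
    then show "norm (alg_uhf_apply (a * b) \<xi>) \<le> norm a * norm b * norm \<xi>"
      by (simp add: apply_mult mult.assoc)
  qed
  show "norm (1::alg_uhf) = 1"
  proof (rule antisym)
    show "norm (1::alg_uhf) \<le> 1" by (rule norm_alg_uhf_le) (simp_all add: apply_one)
    show "1 \<le> norm (1::alg_uhf)"
      using norm_apply_le[of 1 "basis_vec undefined"] by (simp add: apply_one norm_basis_vec)
  qed
  show "k *\<^sub>C (a + b) = k *\<^sub>C a + k *\<^sub>C b" by transfer (simp add: algebra_simps)
  show "(k + l) *\<^sub>C a = k *\<^sub>C a + l *\<^sub>C a" by transfer (simp add: algebra_simps)
  show "k *\<^sub>C l *\<^sub>C a = (k * l) *\<^sub>C a" by transfer (simp add: algebra_simps)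
  show "complex_of_real r *\<^sub>C a = r *\<^sub>R a" by (simp add: scaleR_alg_uhf_def)
  have ncoord: "norm \<xi> = sqrt (\<Sum>s\<in>F. (cmod (coord \<xi> s))\<^sup>2)" if "finite F" "\<And>s. s \<notin> F \<Longrightarrow> coord \<xi> s = 0" for F \<xi>
    unfolding norm_fin_vec_def using that
    by (subst inner_fin_vec_superset[of F]) (auto simp: dot_square_norm)
  have nk: "norm (alg_uhf_apply (k *\<^sub>C a) \<xi>) = cmod k * norm (alg_uhf_apply a \<xi>)" for k \<xi>
  proof -
    have e: "coord (alg_uhf_apply (k *\<^sub>C a) \<xi>) s = k * coord (alg_uhf_apply a \<xi>) s" for s
      by (simp add: coord_apply_support scaleC_alg_uhf.rep_eq sum_distrib_left mult.assoc)
    show ?thesis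
      by (subst (1 2) ncoord[OF finite_coord[of "alg_uhf_apply a \<xi>"]])
         (auto simp: e norm_mult power_mult_distrib real_sqrt_mult simp flip: sum_distrib_left)
  qed
  show "norm (r *\<^sub>R a) = \<bar>r\<bar> * norm a"
    unfolding norm_alg_uhf_def apply_scaleR by (rule onorm_scaleR[OF bounded_linear_apply])
  show "norm (k *\<^sub>C a) = cmod k * norm a"
  proof -
    have le: "norm (k *\<^sub>C a) \<le> cmod k * norm a"
      by (intro norm_alg_uhf_le mult_nonneg_nonneg pos)
         (simp_all add: nk mult.assoc mult_left_mono norm_apply_le)
    show ?thesis
    proof (cases "k = 0")
      case True
      then show ?thesis using le pos[of "k *\<^sub>C a"] by simp
    next
      case False
      have "norm a \<le> norm (k *\<^sub>C a) / cmod k"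
      proof (intro norm_alg_uhf_le divide_nonneg_nonneg pos norm_ge_zero)
        fix \<xi> show "norm (alg_uhf_apply a \<xi>) \<le> norm (k *\<^sub>C a) / cmod k * norm \<xi>"
          using norm_apply_le[of "k *\<^sub>C a" \<xi>] False by (simp add: nk field_simps)
      qed
      then show ?thesis using le False by (simp add: field_simps)
    qed
  qed
  show "adj (a + b) = adj a + adj b" by transfer simp
  show "adj (k *\<^sub>C a) = cnj k *\<^sub>C adj a" by transfer simp
  show "adj (adj a) = a" by transfer simp
  show "adj (a * b) = adj b * adj a"
  proof (rule alg_uhf_eqI)
    fix s t
    obtain f where "entry a = amplify n f" using n(1) by (auto simp: is_local_iff)
    then have "entry (adj a) = amplify n (\<lambda>v w. cnj (f w v))"
      by (auto simp: adj_alg_uhf.rep_eq amplify_def fun_eq_iff)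
    then have la: "is_local n (entry (adj a))" by (auto simp: is_local_iff)
    show "entry (adj (a * b)) s t = entry (adj b * adj a) s t"
      unfolding entry_mult_tail'[OF la] adj_alg_uhf.rep_eq entry_mult_tail[OF n(1)]
      by (simp add: mult.commute)
  qed
  have sq: "(norm x)\<^sup>2 \<le> norm (adj x * x)" for x :: alg_uhf
  proof -
    have "norm x \<le> sqrt (norm (adj x * x))"
    proof (intro norm_alg_uhf_le)
      show "0 \<le> sqrt (norm (adj x * x))" by (simp add: pos)
      fix \<xi>
      have "(norm (alg_uhf_apply x \<xi>))\<^sup>2 = inner \<xi> (alg_uhf_apply (adj x * x) \<xi>)"
        by (simp add: power2_norm_eq_inner inner_apply apply_mult)
      also have "\<dots> \<le> norm \<xi> * norm (alg_uhf_apply (adj x * x) \<xi>)" by (rule norm_cauchy_schwarz)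
      also have "\<dots> \<le> norm \<xi> * (norm (adj x * x) * norm \<xi>)" by (intro mult_left_mono norm_apply_le norm_ge_zero)
      also have "\<dots> = (sqrt (norm (adj x * x)) * norm \<xi>)\<^sup>2"
        by (simp add: power_mult_distrib pos power2_eq_square)
      finally show "norm (alg_uhf_apply x \<xi>) \<le> sqrt (norm (adj x * x)) * norm \<xi>"
        by (rule power2_le_imp_le) (simp add: pos)
    qed
    then show ?thesis using pos[of x] power_mono[of "norm x" "sqrt (norm (adj x * x))" 2] by (simp add: pos)
  qed
  have subm: "norm (x * y) \<le> norm x * norm y" for x y :: alg_uhf
  proof (intro norm_alg_uhf_le mult_nonneg_nonneg pos)
    fix \<xi>
    have "norm (alg_uhf_apply x (alg_uhf_apply y \<xi>)) \<le> norm x * (norm y * norm \<xi>)"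
      by (rule order_trans[OF norm_apply_le mult_left_mono[OF norm_apply_le pos]])
    then show "norm (alg_uhf_apply (x * y) \<xi>) \<le> norm x * norm y * norm \<xi>"
      by (simp add: apply_mult mult.assoc)
  qed
  have le: "norm x \<le> norm (adj x)" for x :: alg_uhf
  proof (cases "norm x = 0")
    case False
    then have "0 < norm x" using pos[of x] by simp
    moreover have "norm x * norm x \<le> norm (adj x) * norm x"
      using sq[of x] subm[of "adj x" x] by (simp add: power2_eq_square)
    ultimately show ?thesis by simp
  qed (simp add: pos)
  have aa: "adj (adj x) = x" for x :: alg_uhf by transfer simp
  show "norm (adj a * a) = (norm a)\<^sup>2"
    using sq[of a] subm[of "adj a" a] le[of a] le[of "adj a"] by (simp add: aa power2_eq_square)
qed

end

section \<open>The UHF algebra and its subalgebras\<close>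

type_synonym uhf = "alg_uhf completion"

definition tensor_power :: "nat \<Rightarrow> alg_uhf set" where
  "tensor_power n = {x. \<exists>a. entry x = amplify n a}"

lift_definition elem_tensor :: "(complex^3^3) list \<Rightarrow> alg_uhf"
  is "\<lambda>xs. amplify (length xs) (\<lambda>v w. \<Prod>i<length xs. xs ! i $ v ! i $ w ! i)"
  by blast

text \<open>The tensor product of \<open>K\<close> in the \<open>m\<close>-th tensor power with an arbitrary \<open>L\<close>. The letter 1 that
  follows the first \<open>m\<close> letters is a dummy, since only these letters matter for such \<open>K\<close>.\<close>

definition mat_tensor ::
  "nat \<Rightarrow> (index_word \<Rightarrow> index_word \<Rightarrow> complex) \<Rightarrow> (index_word \<Rightarrow> index_word \<Rightarrow> complex) \<Rightarrow>
    index_word \<Rightarrow> index_word \<Rightarrow> complex" where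
  "mat_tensor m K L s t =
     K (\<lambda>i. if i < m then s i else 1) (\<lambda>i. if i < m then t i else 1) *
     L (\<lambda>i. s (m + i)) (\<lambda>i. t (m + i))"

lift_definition tensor :: "nat \<Rightarrow> alg_uhf \<Rightarrow> alg_uhf \<Rightarrow> alg_uhf" is mat_tensor
proof -
  fix m K L assume "\<exists>n a. L = amplify n a"
  then obtain q where L: "is_local q L" by (auto simp: is_local_iff)
  have "is_local (m + q) (mat_tensor m K L)"
    unfolding is_local_def
  proof (intro conjI allI impI)
    fix s t i assume "mat_tensor m K L s t \<noteq> 0" and i: "m + q \<le> i"
    then have "L (\<lambda>i. s (m + i)) (\<lambda>i. t (m + i)) \<noteq> 0" by (auto simp: mat_tensor_def)
    then have "s (m + (i - m)) = t (m + (i - m))" by (rule is_localD[OF L]) (use i in simp)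
    then show "s i = t i" using i by simp
  next
    fix s t s' t' :: index_word
    assume 1: "\<forall>i\<ge>m + q. s i = t i \<and> s' i = t' i" and 2: "\<forall>i<m + q. s i = s' i \<and> t i = t' i"
    have "L (\<lambda>i. s (m + i)) (\<lambda>i. t (m + i)) = L (\<lambda>i. s' (m + i)) (\<lambda>i. t' (m + i))"
      by (rule is_local_cong[OF L]) (use 1 2 in auto)
    moreover have "(\<lambda>i. if i < m then s i else 1) = (\<lambda>i. if i < m then s' i else 1)"
      "(\<lambda>i. if i < m then t i else 1) = (\<lambda>i. if i < m then t' i else 1)"
      using 2 by auto
    ultimately show "mat_tensor m K L s t = mat_tensor m K L s' t'"
      unfolding mat_tensor_def by simp
  qed
  then show "\<exists>n a. mat_tensor m K L = amplify n a" unfolding is_local_iff by blast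
qed

lemma tensor_elem_tensor:
  "tensor (length xs) (elem_tensor xs) (elem_tensor ys) = elem_tensor (xs @ ys)"
proof (rule alg_uhf_eqI)
  fix s t :: index_word
  let ?m = "length xs" and ?q = "length ys"
  have tail: "(\<forall>i\<ge>?q. s (?m + i) = t (?m + i)) \<longleftrightarrow> (\<forall>i\<ge>?m + ?q. s i = t i)"
  proof (intro iffI allI impI)
    fix i assume *: "\<forall>i\<ge>?q. s (?m + i) = t (?m + i)" and i: "?m + ?q \<le> i"
    have "s (?m + (i - ?m)) = t (?m + (i - ?m))" using *[rule_format, of "i - ?m"] i by simp
    then show "s i = t i" using i by simp
  qed simp
  have prod: "(\<Prod>i<?m + ?q. (xs @ ys) ! i $ s i $ t i)
      = (\<Prod>i<?m. xs ! i $ s i $ t i) * (\<Prod>i<?q. ys ! i $ s (?m + i) $ t (?m + i))"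
  proof -
    have "(\<Prod>i<?m + k. (xs @ ys) ! i $ s i $ t i)
        = (\<Prod>i<?m. xs ! i $ s i $ t i) * (\<Prod>i<k. ys ! i $ s (?m + i) $ t (?m + i))" for k
      by (induction k) (simp_all add: nth_append mult.assoc)
    then show ?thesis .
  qed
  show "entry (tensor ?m (elem_tensor xs) (elem_tensor ys)) s t = entry (elem_tensor (xs @ ys)) s t"
    by (auto simp: tensor.rep_eq mat_tensor_def elem_tensor.rep_eq amplify_def tail prod)
qed

definition matrix_unit :: "3 \<Rightarrow> 3 \<Rightarrow> complex^3^3" where
  "matrix_unit i j = (\<chi> a b. if a = i \<and> b = j then 1 else 0)"

definition alpha :: "nat \<Rightarrow> 3 \<Rightarrow> alg_uhf" where
  "alpha n j = elem_tensor (matrix_unit j j # replicate n (matrix_unit 2 2))"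

definition beta :: "nat \<Rightarrow> 3 \<Rightarrow> alg_uhf" where
  "beta k j =
     elem_tensor (matrix_unit j j # matrix_unit 1 1 # replicate (k - 1) (matrix_unit 2 2)) +
     elem_tensor (matrix_unit (j + 2) (j + 2) # matrix_unit 3 3 # replicate (k - 1) (matrix_unit 2 2))"

definition fin_subalgebra :: "nat \<Rightarrow> alg_uhf set" where
  "fin_subalgebra n = complex_vector.span
     (range (alpha n) \<union> {tensor (n - k) x (beta k j) | j k x. k \<in> {1..n} \<and> x \<in> tensor_power (n - k)})"

definition subalgebra :: "enat \<Rightarrow> uhf set" where
  "subalgebra N = (case N of
     enat n \<Rightarrow> to_completion ` fin_subalgebra n
   | \<infinity> \<Rightarrow> {a. \<exists>x. (\<forall>n. x n \<in> fin_subalgebra n) \<and> (\<lambda>n. to_completion (x n)) \<longlonglongrightarrow> a})"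

text \<open>The slice map that is the identity on the first \<open>n + 1\<close> tensor factors and applies \<open>\<omega>\<close> to all
  others.\<close>

definition slice_map :: "nat \<Rightarrow> (complex^3^3 \<Rightarrow> complex) \<Rightarrow> uhf \<Rightarrow> uhf" where
  "slice_map n \<omega> = (THE f. bounded_clinear f \<and>
     (\<forall>x\<^sub>0\<in>tensor_power (n + 1). \<forall>xs.
        f (to_completion (tensor (n + 1) x\<^sub>0 (elem_tensor xs))) = (\<Prod>x\<leftarrow>xs. \<omega> x) *\<^sub>C to_completion x\<^sub>0))"

definition state22 :: "complex^3^3 \<Rightarrow> complex" where
  "state22 m = m $ 2 $ 2"

end

(*
  A word s of 3-letters is a basis vector, and a generator x \<otimes> \<beta>^k_j (or \<alpha>_j, the case k = N + 1 with
  scalar x) of A_N is x, acting on the first N - k letters, times the projection onto the words that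
  match a pattern in the later letters; distinct patterns are disjoint and all of them prescribe the
  letter 2 from position N + 2 - k on. Slicing by e22* compresses to the words ending in 2's. An
  element of A_N with nonzero entry (s, t) such that s ends in 2's beyond position n has t ending in
  2's there too, because a matching pattern forces N - k <= n. Hence the compression is
  multiplicative on A_N, and it maps generators to generators of A_n or to 0. For k = \<infinity> one passes
  to limits, using that the finite-dimensional image A_n is closed.
*)

theory Submission
  imports Defs
begin

section \<open>Finite-dimensional subspaces and limits of sets\<close>

text \<open>In the induction step \<open>b\<close> has positive distance from the closed span of \<open>S\<close>, so the coefficient
  of \<open>b\<close> in a Cauchy sequence is Cauchy.\<close>

lemma closed_complex_span_finite:
  fixes S :: "'a::pre_cstar_algebra set"
  assumes "finite S"
  shows "closed (complex_vector.span S)"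
  using assms
proof (induction S)
  case empty
  then show ?case by (simp add: complex_vector.span_empty)
next
  case (insert b S)
  let ?V = "complex_vector.span S"
  show ?case
  proof (cases "b \<in> ?V")
    case True
    then show ?thesis using insert.IH by (simp add: complex_vector.span_redundant)
  next
    case False
    have ne: "?V \<noteq> {}" using complex_vector.span_zero[of S] by blast
    define d where "d = infdist b ?V"
    have d: "d > 0"
      using infdist_pos_not_in_closed[OF insert.IH ne False] by (simp add: d_def)
    have gap: "cmod c * d \<le> norm (v + c *\<^sub>C b)" if v: "v \<in> ?V" for v c
    proof (cases "c = 0")
      case False
      \<comment> \<open>Dividing by c turns \<open>v + c *\<^sub>C b\<close> into the difference of
        b and a point of the span.\<close>
      have "d \<le> dist b ((- inverse c) *\<^sub>C v)"
        unfolding d_def by (intro infdist_le complex_vector.span_scale v)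
      also have "\<dots> = norm (inverse c *\<^sub>C (v + c *\<^sub>C b))"
        using False
        by (simp add: dist_norm complex_vector.scale_right_distrib algebra_simps)
      also have "\<dots> = norm (v + c *\<^sub>C b) / cmod c"
        by (simp add: norm_scaleC norm_inverse divide_inverse mult.commute)
      finally show ?thesis using False by (simp add: field_simps)
    qed simp
    show ?thesis
      unfolding closed_sequential_limits
    proof (intro allI impI, elim conjE)
      fix X l assume X: "\<forall>n. X n \<in> complex_vector.span (insert b S)" and l: "X \<longlonglongrightarrow> l"
      have "\<exists>c. X n - c *\<^sub>C b \<in> ?V" for n
        using X complex_vector.span_insert[of b S] by auto
      then obtain c where c: "\<And>n. X n - c n *\<^sub>C b \<in> ?V" by metis
      have "Cauchy c"
      proof (rule CauchyI)
        fix e :: real assume "e > 0"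
        then have "e * d > 0" using d by simp
        then obtain M where M: "\<And>m n. m \<ge> M \<Longrightarrow> n \<ge> M \<Longrightarrow> norm (X m - X n) < e * d"
          using CauchyD[OF LIMSEQ_imp_Cauchy[OF l]] by meson
        have "norm (c m - c n) < e" if "m \<ge> M" "n \<ge> M" for m n
        proof -
          have "cmod (c m - c n) * d \<le> norm ((X m - c m *\<^sub>C b) - (X n - c n *\<^sub>C b) + (c m - c n) *\<^sub>C b)"
            by (intro gap complex_vector.span_diff c)
          also have "\<dots> = norm (X m - X n)"
            by (simp add: complex_vector.scale_left_diff_distrib)
          also have "\<dots> < e * d" using M that by blast
          finally show ?thesis using d by simp
        qed
        then show "\<exists>M. \<forall>m\<ge>M. \<forall>n\<ge>M. norm (c m - c n) < e" by blast
      qed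
      then obtain c' where c': "c \<longlonglongrightarrow> c'" using Cauchy_convergent_iff convergent_def by blast
      have "bounded_linear (\<lambda>z. z *\<^sub>C b)"
      proof (rule bounded_linear_intro[of _ "norm b"])
        show "(r *\<^sub>R z) *\<^sub>C b = r *\<^sub>R z *\<^sub>C b" for r z
          by (simp add: scaleR_conv_of_real[where 'a=complex] scaleC_scaleC flip: scaleC_of_real)
      qed (simp_all add: scaleC_add_left norm_scaleC)
      then have "(\<lambda>n. X n - c n *\<^sub>C b) \<longlonglongrightarrow> l - c' *\<^sub>C b"
        using tendsto_diff[OF l bounded_linear.tendsto[OF _ c']] by blast
      then have "l - c' *\<^sub>C b \<in> ?V"
        using closed_sequentially[OF insert.IH, of "\<lambda>n. X n - c n *\<^sub>C b"] c by blast
      then show "l \<in> complex_vector.span (insert b S)"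
        by (auto simp: complex_vector.span_insert)
    qed
  qed
qed

text \<open>An independent subset of a finite span is finite, so V is itself the span of a finite
  basis.\<close>

lemma closed_complex_subspace_finite:
  fixes V :: "'a::pre_cstar_algebra set"
  assumes V: "complex_vector.subspace V" and S: "finite S" "V \<subseteq> complex_vector.span S"
  shows "closed V"
proof -
  obtain B where B: "B \<subseteq> V" "complex_vector.independent B" "V \<subseteq> complex_vector.span B"
    using complex_vector.basis_exists by metis
  then have "finite B"
    using complex_vector.independent_span_bound[OF S(1) B(2)] S(2) by blast
  moreover have "V = complex_vector.span B"
    using B complex_vector.span_minimal[OF B(1) V] by blast
  ultimately show ?thesis using closed_complex_span_finite by metis
qed

text \<open>A point is such a limit exactly when its distance to \<open>S n\<close> tends to 0, and
  this condition is closed. In general the limit set is not the closure of the union of the sets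
  \<open>S n\<close>.\<close>

lemma closed_limits_of_sets:
  fixes S :: "nat \<Rightarrow> 'a::metric_space set"
  assumes ne: "\<And>n. S n \<noteq> {}"
  shows "closed {a. \<exists>x. (\<forall>n. x n \<in> S n) \<and> x \<longlonglongrightarrow> a}" (is "closed ?L")
  unfolding closed_sequential_limits
proof (intro allI impI, elim conjE)
  fix X a assume X: "\<forall>n. X n \<in> ?L" and a: "X \<longlonglongrightarrow> a"
  \<comment> \<open>The infimum need not be attained, hence the slack, which tends to 0.\<close>
  have "\<exists>y\<in>S n. dist a y < infdist a (S n) + inverse (real (Suc n))" for n
  proof (rule ccontr)
    assume "\<not> ?thesis"
    then have "infdist a (S n) + inverse (real (Suc n)) \<le> infdist a (S n)"
      unfolding infdist_notempty[OF ne] using ne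
      by (intro cINF_greatest) (auto simp: not_less infdist_notempty[OF ne])
    then show False by simp
  qed
  then obtain x where x: "\<And>n. x n \<in> S n" "\<And>n. dist a (x n) < infdist a (S n) + inverse (real (Suc n))"
    by metis
  have "(\<lambda>n. infdist a (S n)) \<longlonglongrightarrow> 0"
  proof (rule LIMSEQ_I)
    fix e :: real assume e: "e > 0"
    \<comment> \<open>Half of e is spent between a and one fixed \<open>X m\<close>, the other half
      on the sequence that approximates this \<open>X m\<close>.\<close>
    obtain m where m: "dist (X m) a < e / 2"
      using metric_LIMSEQ_D[OF a, of "e / 2"] e by auto
    obtain y where y: "\<And>n. y n \<in> S n" "y \<longlonglongrightarrow> X m" using X by blast
    obtain M where M: "\<And>n. n \<ge> M \<Longrightarrow> dist (y n) (X m) < e / 2"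
      using metric_LIMSEQ_D[OF y(2), of "e / 2"] e by auto
    have "infdist a (S n) < e" if "n \<ge> M" for n
    proof -
      have "infdist a (S n) \<le> dist a (y n)" by (rule infdist_le[OF y(1)])
      also have "\<dots> \<le> dist (X m) a + dist (y n) (X m)"
        by (metis dist_commute dist_triangle)
      finally show ?thesis using m M[OF that] by simp
    qed
    then show "\<exists>M. \<forall>n\<ge>M. norm (infdist a (S n) - 0) < e"
      by (auto simp: infdist_nonneg)
  qed
  from tendsto_add[OF this LIMSEQ_inverse_real_of_nat]
  have "(\<lambda>n. infdist a (S n) + inverse (real (Suc n))) \<longlonglongrightarrow> 0" by simp
  then have "(\<lambda>n. dist (x n) a) \<longlonglongrightarrow> 0"
    by (rule Lim_null_comparison[rotated])
      (use x(2) in \<open>auto simp: dist_commute intro!: always_eventually less_imp_le\<close>)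
  then show "a \<in> ?L" using x(1) tendsto_dist_iff by blast
qed

section \<open>Matrix units\<close>

lemma in_tensor_power_iff: "x \<in> tensor_power n \<longleftrightarrow> is_local n (entry x)"
  by (auto simp: tensor_power_def is_local_iff)

lemma entry_sum: "entry (\<Sum>i\<in>I. f i) s t = (\<Sum>i\<in>I. entry (f i) s t)"
  by (induction I rule: infinite_finite_induct)
    (simp_all add: zero_alg_uhf.rep_eq plus_alg_uhf.rep_eq)

text \<open>The entry is a coordinate of the image of the unit vector
  \<open>basis_vec t\<close>.\<close>

lemma norm_entry_le: "cmod (entry x s t) \<le> norm x"
proof -
  let ?\<eta> = "alg_uhf_apply x (basis_vec t)"
  have "(cmod (coord ?\<eta> s))\<^sup>2 \<le> (norm ?\<eta>)\<^sup>2"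
  proof (cases "coord ?\<eta> s = 0")
    case False
    then have "(cmod (coord ?\<eta> s))\<^sup>2 \<le> (\<Sum>s | coord ?\<eta> s \<noteq> 0. (cmod (coord ?\<eta> s))\<^sup>2)"
      by (intro member_le_sum finite_coord) auto
    then show ?thesis
      unfolding power2_norm_eq_inner by (simp add: inner_fin_vec_def dot_square_norm)
  qed simp
  then have "cmod (coord ?\<eta> s) \<le> norm ?\<eta>" by (rule power2_le_imp_le) simp
  also have "\<dots> \<le> norm x" using norm_apply_le[of x "basis_vec t"] by (simp add: norm_basis_vec)
  finally show ?thesis by (simp add: coord_apply_basis)
qed

lemma prod_of_bool: "finite I \<Longrightarrow> (\<Prod>i\<in>I. of_bool (P i)) = (of_bool (\<forall>i\<in>I. P i) :: complex)"
  by (induction I rule: finite_induct) auto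

lemma matrix_unit_nth: "matrix_unit i j $ a $ b = of_bool (a = i \<and> b = j)"
  by (simp add: matrix_unit_def)

text \<open>The matrix unit of the n-fold tensor power for the first n letters of v and w. Infinite
  words serve as labels so that its coefficient in x is directly \<open>entry x v w\<close>.\<close>

definition word_unit :: "nat \<Rightarrow> index_word \<Rightarrow> index_word \<Rightarrow> alg_uhf" where
  "word_unit n v w = elem_tensor (map (\<lambda>i. matrix_unit (v i) (w i)) [0..<n])"

lemma entry_word_unit:
  "entry (word_unit n v w) s t =
    of_bool ((\<forall>i<n. s i = v i \<and> t i = w i) \<and> (\<forall>i\<ge>n. s i = t i))"
proof (cases "\<forall>i\<ge>n. s i = t i")
  case True
  then show ?thesis
    by (simp add: word_unit_def elem_tensor.rep_eq amplify_def matrix_unit_nth prod_of_bool Ball_def)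
next
  case False
  then show ?thesis
    by (simp only: word_unit_def elem_tensor.rep_eq amplify_def length_map length_upt diff_zero
      if_False simp_thms of_bool_eq)
qed

text \<open>The padding letter is 2 because \<open>state22\<close> reads off the entry (2, 2) in
  every tensor factor from position n on.\<close>

definition cut :: "nat \<Rightarrow> index_word \<Rightarrow> index_word" where
  "cut n s = (\<lambda>i. if i < n then s i else 2)"

text \<open>Representatives of the words of length n, each continued by 2's.\<close>

abbreviation words :: "nat \<Rightarrow> index_word set" where
  "words n \<equiv> tail_class n (\<lambda>i. 2)"

lemma cut_in_words: "cut n s \<in> words n"
  by (simp add: cut_def tail_class_def)

text \<open>Exactly one pair of representatives agrees with s and t on the first n letters, so a
  single term survives in each entry. The expansion reduces linear statements to matrix
  units.\<close>

lemma local_expansion: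
  assumes x: "is_local n (entry x)"
  shows "x = (\<Sum>(v, w)\<in>words n \<times> words n. entry x v w *\<^sub>C word_unit n v w)"
proof (rule alg_uhf_eqI)
  fix s t
  have fin: "finite (words n \<times> words n)" by (simp add: finite_tail_class)
  have eq: "v = cut n s \<longleftrightarrow> (\<forall>i<n. s i = v i)" if "v \<in> words n" for v s
    using that by (auto simp: cut_def tail_class_def fun_eq_iff)
  have "entry (\<Sum>(v, w)\<in>words n \<times> words n. entry x v w *\<^sub>C word_unit n v w) s t
      = (\<Sum>p\<in>words n \<times> words n. if p = (cut n s, cut n t)
          then entry x (cut n s) (cut n t) * of_bool (\<forall>i\<ge>n. s i = t i) else 0)"
    unfolding entry_sum
    by (intro sum.cong) (auto simp: scaleC_alg_uhf.rep_eq entry_word_unit eq, simp_all add: cut_def)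
  also have "\<dots> = entry x (cut n s) (cut n t) * of_bool (\<forall>i\<ge>n. s i = t i)"
    using fin by (simp add: cut_in_words)
  also have "\<dots> = entry x s t"
  proof (cases "\<forall>i\<ge>n. s i = t i")
    case True
    then have "entry x (cut n s) (cut n t) = entry x s t"
      by (intro is_local_cong[OF x]) (auto simp: cut_def)
    with True show ?thesis by simp
  next
    case False
    then show ?thesis using is_localD[OF x] by auto
  qed
  finally show "entry x s t = entry (\<Sum>(v, w)\<in>words n \<times> words n. entry x v w *\<^sub>C word_unit n v w) s t" ..
qed

section \<open>The slice map\<close>

text \<open>The matrix of the slice tensored with the identity: the compression of K to the words
  that continue with 2's from position n on, repeated for all other tails.\<close>

definition slice_kernel ::
  "nat \<Rightarrow> (index_word \<Rightarrow> index_word \<Rightarrow> complex) \<Rightarrow> index_word \<Rightarrow> index_word \<Rightarrow> complex" where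
  "slice_kernel n K s t = (if \<forall>i\<ge>n. s i = t i then K (cut n s) (cut n t) else 0)"

lemma is_local_slice_kernel: "is_local n (slice_kernel n K)"
  unfolding is_local_def slice_kernel_def
proof (intro conjI allI impI)
  fix s t s' t' :: index_word
  assume 1: "\<forall>i\<ge>n. s i = t i \<and> s' i = t' i" and 2: "\<forall>i<n. s i = s' i \<and> t i = t' i"
  have "cut n s = cut n s'" "cut n t = cut n t'" using 2 by (auto simp: cut_def fun_eq_iff)
  then show "(if \<forall>i\<ge>n. s i = t i then K (cut n s) (cut n t) else 0) =
     (if \<forall>i\<ge>n. s' i = t' i then K (cut n s') (cut n t') else 0)" using 1 by simp
qed (auto split: if_splits)

lift_definition slice :: "nat \<Rightarrow> alg_uhf \<Rightarrow> alg_uhf" is slice_kernel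
  using is_local_slice_kernel is_local_iff by blast

lemma entry_slice:
  "entry (slice n x) s t = (if \<forall>i\<ge>n. s i = t i then entry x (cut n s) (cut n t) else 0)"
  by (simp add: slice.rep_eq slice_kernel_def)

lemma is_local_slice: "is_local n (entry (slice n x))"
  unfolding slice.rep_eq by (rule is_local_slice_kernel)

lemma slice_add: "slice n (x + y) = slice n x + slice n y"
  by transfer (auto simp: slice_kernel_def fun_eq_iff)

lemma slice_scaleC: "slice n (c *\<^sub>C x) = c *\<^sub>C slice n x"
  by transfer (auto simp: slice_kernel_def fun_eq_iff)

lemma slice_adj: "slice n (adj x) = adj (slice n x)"
  by transfer (auto simp: slice_kernel_def fun_eq_iff)

text \<open>The image lies in the span of finitely many matrix units, and its coefficients are
  entries of x, bounded by \<open>norm_entry_le\<close>.\<close>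

lemma bounded_linear_slice: "bounded_linear (slice n)"
proof (rule bounded_linear_intro[where K = "\<Sum>(v, w)\<in>words n \<times> words n. norm (word_unit n v w)"])
  fix r x
  show "slice n (r *\<^sub>R x) = r *\<^sub>R slice n x"
    by (simp add: slice_scaleC flip: scaleC_of_real)
  have "cmod (entry (slice n x) v w) \<le> norm x" for v w
    by (simp add: entry_slice norm_entry_le)
  then have "norm (slice n x) \<le> (\<Sum>p\<in>words n \<times> words n. norm x * norm (case p of (v, w) \<Rightarrow> word_unit n v w))"
    by (subst local_expansion[OF is_local_slice])
      (intro sum_norm_le, auto simp: norm_scaleC intro!: mult_right_mono)
  then show "norm (slice n x) \<le> norm x * (\<Sum>(v, w)\<in>words n \<times> words n. norm (word_unit n v w))"
    by (simp add: sum_distrib_left case_prod_unfold)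
qed (rule slice_add)

text \<open>Fixing the tail letters to 2 evaluates each factor of the elementary tensor at its entry
  (2, 2).\<close>

lemma slice_tensor:
  assumes x: "is_local n (entry x)"
  shows "slice n (tensor n x (elem_tensor ys)) = (\<Prod>y\<leftarrow>ys. state22 y) *\<^sub>C x"
proof (rule alg_uhf_eqI)
  fix s t
  have *: "(\<Prod>y\<leftarrow>ys. state22 y) = (\<Prod>i<length ys. ys ! i $ 2 $ 2)"
    by (simp add: prod.list_conv_set_nth state22_def atLeast0LessThan)
  have [simp]: "cut n s (n + i) = 2" for s i by (simp add: cut_def)
  show "entry (slice n (tensor n x (elem_tensor ys))) s t =
      entry ((\<Prod>y\<leftarrow>ys. state22 y) *\<^sub>C x) s t"
  proof (cases "\<forall>i\<ge>n. s i = t i")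
    case True
    \<comment> \<open>\<open>mat_tensor\<close> pads the words for x with the letter 1; locality of
      x allows restoring the common tail of s and t.\<close>
    have "entry x (\<lambda>i. if i < n then cut n s i else 1) (\<lambda>i. if i < n then cut n t i else 1) = entry x s t"
      by (rule is_local_cong[OF x]) (use True in \<open>auto simp: cut_def\<close>)
    then show ?thesis
      using True by (simp add: entry_slice tensor.rep_eq mat_tensor_def * scaleC_alg_uhf.rep_eq
        elem_tensor.rep_eq amplify_def)
  next
    case False
    then have "entry x s t = 0" using is_localD[OF x] by blast
    then show ?thesis
      unfolding entry_slice if_not_P[OF False] by (simp add: scaleC_alg_uhf.rep_eq)
  qed
qed

section \<open>Extension of the slice to the completion\<close>

lift_definition slice_ext :: "nat \<Rightarrow> uhf \<Rightarrow> uhf" is "\<lambda>n X m. slice n (X m)"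
  by (rule cauchy_rel_bounded_linear[OF bounded_linear_slice])

lemma slice_ext_to_completion: "slice_ext n (to_completion x) = to_completion (slice n x)"
  by transfer (rule cauchy_rel_const)

lemma to_completion_approx:
  fixes a :: "'a::pre_cstar_algebra completion"
  obtains x where "(\<lambda>m. to_completion (x m)) \<longlonglongrightarrow> a"
proof -
  have "\<exists>x. norm (a - to_completion x) < inverse (real (Suc m))" for m
    using to_completion_dense[of "inverse (real (Suc m))" a] by auto
  then obtain x where x: "\<And>m. norm (a - to_completion (x m)) < inverse (real (Suc m))" by metis
  have "(\<lambda>m. to_completion (x m) - a) \<longlonglongrightarrow> 0"
    by (rule Lim_null_comparison[OF _ LIMSEQ_inverse_real_of_nat])
      (use x in \<open>auto simp: norm_minus_commute intro!: always_eventually less_imp_le\<close>)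
  then have "(\<lambda>m. to_completion (x m)) \<longlonglongrightarrow> a" by (simp add: LIM_zero_iff)
  then show ?thesis by (rule that)
qed

lemma slice_ext_add: "slice_ext n (a + b) = slice_ext n a + slice_ext n b"
  by transfer (simp add: slice_add cauchy_rel_add cauchy_rel_bounded_linear[OF bounded_linear_slice])

lemma slice_ext_scaleC: "slice_ext n (c *\<^sub>C a) = c *\<^sub>C slice_ext n a"
  by transfer (simp add: slice_scaleC cauchy_rel_bounded_linear[OF bounded_linear_scaleC]
    cauchy_rel_bounded_linear[OF bounded_linear_slice])

lemma slice_ext_adj: "slice_ext n (adj a) = adj (slice_ext n a)"
  by transfer (simp add: slice_adj cauchy_rel_bounded_linear[OF bounded_linear_adj]
    cauchy_rel_bounded_linear[OF bounded_linear_slice])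

lemma bounded_clinear_slice_ext: "bounded_clinear (slice_ext n)"
  unfolding bounded_clinear_def
proof (intro conjI allI slice_ext_scaleC)
  obtain C where C: "\<And>x. norm (slice n x) \<le> norm x * C"
    using bounded_linear.bounded[OF bounded_linear_slice] by blast
  show "bounded_linear (slice_ext n)"
  proof (rule bounded_linear_intro[where K = C, OF slice_ext_add])
    show "slice_ext n (r *\<^sub>R a) = r *\<^sub>R slice_ext n a" for r a
      by (simp add: slice_ext_scaleC flip: scaleC_of_real)
    show "norm (slice_ext n a) \<le> norm a * C" for a
    proof (transfer fixing: n C)
      fix X :: "nat \<Rightarrow> alg_uhf" assume "cauchy_rel X X"
      then have X: "Cauchy X" and Y: "Cauchy (\<lambda>m. slice n (X m))"
        by (auto simp: cauchy_rel_def intro: bounded_linear.Cauchy[OF bounded_linear_slice])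
      show "lim (\<lambda>m. norm (slice n (X m))) \<le> lim (\<lambda>m. norm (X m)) * C"
        using cauchy_norm_convergent[OF X] cauchy_norm_convergent[OF Y] C
        by (intro LIMSEQ_le[of "\<lambda>m. norm (slice n (X m))" _ "\<lambda>m. norm (X m) * C"] tendsto_mult_right)
          (auto simp: convergent_LIMSEQ_iff)
    qed
  qed
qed

text \<open>Brings a matrix unit into the form on which the defining property of
  \<open>slice_map\<close> prescribes the value.\<close>

lemma word_unit_split:
  assumes "n \<le> m"
  shows "word_unit m v w = tensor n (word_unit n v w)
    (elem_tensor (map (\<lambda>i. matrix_unit (v i) (w i)) [n..<m]))"
proof -
  have "[0..<m] = [0..<n] @ [n..<m]"
    using assms upt_add_eq_append[of 0 n "m - n"] by simp
  then show ?thesis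
    using tensor_elem_tensor[of "map (\<lambda>i. matrix_unit (v i) (w i)) [0..<n]"]
    by (simp add: word_unit_def)
qed

lemma is_local_word_unit: "is_local n (entry (word_unit n v w))"
  using is_local_iff by (fastforce simp: word_unit_def elem_tensor.rep_eq)

lemma to_completion_sum: "to_completion (\<Sum>i\<in>I. f i) = (\<Sum>i\<in>I. to_completion (f i))"
  using to_completion_diff[of 0 "0::'a::pre_cstar_algebra"]
  by (induction I rule: infinite_finite_induct) (simp_all add: to_completion_add)

text \<open>\<open>slice_ext\<close> has the defining property by \<open>slice_tensor\<close>. Any
  other such map agrees with it on matrix units, which span a dense subalgebra, and both are
  continuous.\<close>

lemma slice_map_state22: "slice_map n state22 = slice_ext (n + 1)"
  unfolding slice_map_def
proof (rule the_equality)
  show "bounded_clinear (slice_ext (n + 1)) \<and> (\<forall>x\<^sub>0\<in>tensor_power (n + 1). \<forall>xs.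
      slice_ext (n + 1) (to_completion (tensor (n + 1) x\<^sub>0 (elem_tensor xs))) =
      (\<Prod>x\<leftarrow>xs. state22 x) *\<^sub>C to_completion x\<^sub>0)"
    using bounded_clinear_slice_ext slice_tensor
    by (simp add: slice_ext_to_completion to_completion_scaleC in_tensor_power_iff)
next
  fix f :: "uhf \<Rightarrow> uhf"
  assume f: "bounded_clinear f \<and> (\<forall>x\<^sub>0\<in>tensor_power (n + 1). \<forall>xs.
      f (to_completion (tensor (n + 1) x\<^sub>0 (elem_tensor xs))) =
      (\<Prod>x\<leftarrow>xs. state22 x) *\<^sub>C to_completion x\<^sub>0)"
  then have bl: "bounded_linear f" and sc: "f (c *\<^sub>C a) = c *\<^sub>C f a" for c a
    by (auto simp: bounded_clinear_def)
  have bl': "bounded_linear (slice_ext (n + 1))"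
    using bounded_clinear_slice_ext by (simp add: bounded_clinear_def)
  have unit: "f (to_completion (word_unit m v w)) = slice_ext (n + 1) (to_completion (word_unit m v w))"
    if "n + 1 \<le> m" for m v w
    unfolding slice_ext_to_completion word_unit_split[OF that]
    using f by (subst slice_tensor)
      (auto simp: to_completion_scaleC in_tensor_power_iff is_local_word_unit)
  have alg: "f (to_completion x) = slice_ext (n + 1) (to_completion x)" for x
  proof -
    obtain m where "is_local m (entry x)" by (rule is_local_entry)
    \<comment> \<open>A level of at least n + 1 makes every matrix unit of the expansion split after
      n + 1 letters.\<close>
    then have m: "is_local (max m (n + 1)) (entry x)" by (rule is_local_mono) simp
    show ?thesis
      by (subst (1 2) local_expansion[OF m])
        (simp add: to_completion_sum linear_sum[OF bounded_linear.linear[OF bl]]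
          linear_sum[OF bounded_linear.linear[OF bl']] case_prod_unfold to_completion_scaleC
          sc slice_ext_scaleC unit del: One_nat_def)
  qed
  show "f = slice_ext (n + 1)"
  proof
    fix a :: uhf
    obtain x where x: "(\<lambda>m. to_completion (x m)) \<longlonglongrightarrow> a" by (rule to_completion_approx)
    show "f a = slice_ext (n + 1) a"
      using LIMSEQ_unique[OF bounded_linear.tendsto[OF bl x]] bounded_linear.tendsto[OF bl' x]
      by (simp add: alg)
  qed
qed

section \<open>The finite-dimensional algebras\<close>

text \<open>The words that the generator with parameters \<open>k, j\<close> selects; \<open>k = N + 1\<close> stands for \<open>alpha N j\<close>.\<close>

definition pattern :: "nat \<Rightarrow> nat \<Rightarrow> 3 \<Rightarrow> index_word \<Rightarrow> bool" where
  "pattern N k j s \<longleftrightarrow> (\<forall>i\<in>{N + 2 - k..N}. s i = 2) \<and>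
     (if k = N + 1 then s 0 = j
      else s (N - k) = j \<and> s (N + 1 - k) = 1 \<or> s (N - k) = j + 2 \<and> s (N + 1 - k) = 3)"

text \<open>For \<open>k = N + 1\<close> the truncated difference \<open>N - k\<close> is 0, so that \<open>x\<close> is a scalar.\<close>

definition pieces :: "nat \<Rightarrow> alg_uhf set" where
  "pieces N = {g. \<exists>x k j. k \<in> {1..N + 1} \<and> is_local (N - k) (entry x) \<and>
     (\<forall>s t. entry g s t = entry x s t * of_bool (pattern N k j t))}"

text \<open>This letter is 1 or 3. Together with the 2's that follow it, it reveals k.\<close>

lemma pattern_letter:
  assumes "pattern N k j s" "k \<le> N" shows "s (N + 1 - k) \<noteq> 2"
  using assms by (auto simp: pattern_def)

text \<open>For k < l the pattern of l demands the letter 2 at \<open>N + 1 - k\<close>, where that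
  of k forbids it. For equal k at most N, the letter 1 or 3 there tells whether the preceding letter
  is j or j + 2, so j is determined; for \<open>k = N + 1\<close> it is the first letter.\<close>

lemma pattern_unique:
  assumes "pattern N k j s" "pattern N l i s" "k \<in> {1..N + 1}" "l \<in> {1..N + 1}"
  shows "k = l \<and> j = i"
proof -
  have not_less: "\<not> k' < l'" if "pattern N k' j' s" "pattern N l' i' s" "k' \<in> {1..N + 1}" "l' \<in> {1..N + 1}"
    for k' l' j' i'
  proof
    assume "k' < l'"
    then have "N + 1 - k' \<in> {N + 2 - l'..N}" "k' \<le> N" using that by auto
    then show False using pattern_letter[OF that(1)] that(2) unfolding pattern_def by blast
  qed
  then have "k = l" using assms by (meson linorder_neqE_nat)
  moreover from this have "j = i" using assms(1,2) by (auto simp: pattern_def split: if_splits)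
  ultimately show ?thesis ..
qed

text \<open>A pattern looks only at letters from \<open>N - k\<close> on, which the factor x of a
  piece leaves alone.\<close>

lemma pattern_cong_ge:
  assumes "\<And>i. i \<ge> N - k \<Longrightarrow> s i = t i"
  shows "pattern N k j s = pattern N k j t"
proof -
  have "(\<forall>i\<in>{N + 2 - k..N}. s i = 2) \<longleftrightarrow> (\<forall>i\<in>{N + 2 - k..N}. t i = 2)"
    using assms by (intro ball_cong) auto
  moreover have "s (N - k) = t (N - k)" "s (N + 1 - k) = t (N + 1 - k)"
    "k = N + 1 \<Longrightarrow> s 0 = t 0" using assms by auto
  ultimately show ?thesis by (simp add: pattern_def)
qed

lemma pattern_cong_le:
  assumes "\<And>i. i \<le> N \<Longrightarrow> s i = t i" "k \<ge> 1"
  shows "pattern N k j s = pattern N k j t"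
  using assms by (auto simp: pattern_def)

section \<open>Generators as projections onto patterns\<close>

lemma alpha_eq_word_unit:
  "alpha N j = word_unit (Suc N) (\<lambda>i. if i = 0 then j else 2) (\<lambda>i. if i = 0 then j else 2)"
  unfolding alpha_def word_unit_def
  by (rule arg_cong[where f = elem_tensor], rule nth_equalityI) (auto simp: nth_Cons' simp del: upt_Suc)

text \<open>A diagonal matrix unit projects onto the words with its letters; here these form the
  pattern with \<open>k = N + 1\<close>.\<close>

lemma entry_alpha: "entry (alpha N j) s t = of_bool (s = t \<and> pattern N (N + 1) j t)"
proof -
  have "(\<forall>i<Suc N. s i = (if i = 0 then j else 2) \<and> t i = (if i = 0 then j else 2)) \<and>
      (\<forall>i\<ge>Suc N. s i = t i) \<longleftrightarrow> s = t \<and> pattern N (N + 1) j t" (is "?L \<longleftrightarrow> ?R")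
  proof
    assume L: ?L
    have "s i = t i" for i using L by (cases "i < Suc N") (auto simp: not_less)
    then show ?R using L by (auto simp: pattern_def)
  qed (auto simp: pattern_def)
  then show ?thesis by (simp only: alpha_eq_word_unit entry_word_unit)
qed

lemma beta_eq_word_unit:
  assumes "k \<ge> 1"
  shows "beta k j = word_unit (Suc k) ((\<lambda>i. 2)(0 := j, 1 := 1)) ((\<lambda>i. 2)(0 := j, 1 := 1)) +
    word_unit (Suc k) ((\<lambda>i. 2)(0 := j + 2, 1 := 3)) ((\<lambda>i. 2)(0 := j + 2, 1 := 3))"
  unfolding beta_def word_unit_def using assms
  by (intro arg_cong2[where f = "(+)"] arg_cong[where f = elem_tensor] nth_equalityI)
    (auto simp: nth_Cons' simp del: upt_Suc)

lemma entry_beta: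
  assumes "k \<ge> 1"
  shows "entry (beta k j) s t = of_bool (s = t \<and> pattern k k j t)"
proof -
  have *: "(\<forall>i<Suc k. s i = ((\<lambda>i. 2)(0 := a, 1 := b)) i \<and> t i = ((\<lambda>i. 2)(0 := a, 1 := b)) i) \<and>
      (\<forall>i\<ge>Suc k. s i = t i) \<longleftrightarrow> s = t \<and> (\<forall>i\<in>{2..k}. t i = 2) \<and> t 0 = a \<and> t 1 = b"
    (is "?L \<longleftrightarrow> ?R") for a b
  proof
    assume L: ?L
    have "s i = t i" for i using L by (cases "i < Suc k") (auto simp: not_less)
    moreover have "t 0 = a" "t 1 = b" using L assms by (auto simp: less_Suc_eq_le)
    ultimately show ?R using L by auto
  next
    assume ?R
    moreover from this have "t i = 2" if "i < Suc k" "i \<noteq> 0" "i \<noteq> 1" for i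
      using that by auto
    ultimately show ?L by auto
  qed
  \<comment> \<open>The two summands of beta have the distinct second letters 1 and 3, so no word
    matches both and the sum of the two indicators is again an indicator.\<close>
  have "(1::3) \<noteq> 3" by simp
  then show ?thesis
    unfolding beta_eq_word_unit[OF assms] plus_alg_uhf.rep_eq entry_word_unit * pattern_def
    by (auto split: if_splits)
qed

text \<open>\<open>beta k j\<close> is a diagonal projection, and shifting its pattern by
  \<open>N - k\<close> letters gives the pattern for N. A diagonal right factor only restricts the
  column index.\<close>

lemma entry_tensor_beta:
  assumes k: "k \<in> {1..N}" and x: "is_local (N - k) (entry x)"
  shows "entry (tensor (N - k) x (beta k j)) s t = entry x s t * of_bool (pattern N k j t)"
proof -
  define m where "m = N - k"
  have N: "N = m + k" using k by (simp add: m_def)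
  have sh: "pattern k k j (\<lambda>i. t (m + i)) = pattern N k j t"
  proof -
    have "(\<forall>i\<in>{2..k}. t (m + i) = 2) \<longleftrightarrow> (\<forall>i\<in>{m + 2..m + k}. t i = 2)"
    proof (intro iffI ballI)
      fix i assume *: "\<forall>i\<in>{2..k}. t (m + i) = 2" and i: "i \<in> {m + 2..m + k}"
      then have "i - m \<in> {2..k}" "m + (i - m) = i" by auto
      then show "t i = 2" using * by metis
    qed simp
    then show ?thesis by (simp add: pattern_def N)
  qed
  have "(\<lambda>i. s (m + i)) = (\<lambda>i. t (m + i)) \<longleftrightarrow> (\<forall>i\<ge>m. s i = t i)"
    unfolding fun_eq_iff using le_add_diff_inverse le_add1 by metis
  then have b: "entry (beta k j) (\<lambda>i. s (m + i)) (\<lambda>i. t (m + i)) =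
      of_bool ((\<forall>i\<ge>m. s i = t i) \<and> pattern N k j t)"
    using k by (simp only: entry_beta atLeastAtMost_iff sh)
  show ?thesis
  proof (cases "\<forall>i\<ge>m. s i = t i")
    case True
    have "entry x (\<lambda>i. if i < m then s i else 1) (\<lambda>i. if i < m then t i else 1) = entry x s t"
      by (rule is_local_cong[OF x[folded m_def]]) (use True in auto)
    then show ?thesis
      unfolding m_def[symmetric] tensor.rep_eq mat_tensor_def b using True by simp
  next
    case False
    then have "entry x s t = 0" using is_localD[OF x[folded m_def]] by blast
    then show ?thesis
      unfolding m_def[symmetric] tensor.rep_eq mat_tensor_def b by (simp only: False) simp
  qed
qed

text \<open>The 0-fold tensor power consists of scalars. This turns a piece with
  \<open>k = N + 1\<close> into a multiple of \<open>alpha N j\<close>.\<close>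

lemma is_local_0:
  assumes "is_local 0 (entry x)"
  shows "entry x s t = entry x (\<lambda>i. 2) (\<lambda>i. 2) * of_bool (s = t)"
proof (cases "s = t")
  case True
  then show ?thesis using is_local_cong[OF assms, of s t "\<lambda>i. 2" "\<lambda>i. 2"] by simp
next
  case False
  then show ?thesis using is_localD[OF assms, of s t] by (auto simp: fun_eq_iff)
qed

text \<open>Pieces describe both kinds of generators by one formula for the entries, so that closure
  properties can be proved for both at once; \<open>alpha N j\<close> is the piece with x =
  1.\<close>

lemma fin_subalgebra_eq: "fin_subalgebra N = complex_vector.span (pieces N)"
proof (rule antisym)
  show "fin_subalgebra N \<subseteq> complex_vector.span (pieces N)"
    unfolding fin_subalgebra_def
  proof (intro complex_vector.span_mono Un_least subsetI)
    fix g assume "g \<in> range (alpha N)"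
    then obtain j where g: "g = alpha N j" by blast
    have "is_local (N - (N + 1)) (entry 1)" by (auto simp: is_local_def one_alg_uhf.rep_eq)
    then show "g \<in> pieces N"
      unfolding pieces_def g
      by (intro CollectI exI[of _ 1] exI[of _ "N + 1"] exI[of _ j])
        (auto simp: entry_alpha one_alg_uhf.rep_eq)
  next
    fix g assume "g \<in> {tensor (N - k) x (beta k j) |j k x. k \<in> {1..N} \<and> x \<in> tensor_power (N - k)}"
    then show "g \<in> pieces N"
      unfolding pieces_def in_tensor_power_iff using entry_tensor_beta by fastforce
  qed
  show "complex_vector.span (pieces N) \<subseteq> fin_subalgebra N"
    unfolding fin_subalgebra_def
  proof (rule complex_vector.span_minimal[OF _ complex_vector.subspace_span], rule subsetI)
    let ?G = "range (alpha N) \<union> {tensor (N - k) x (beta k j) |j k x. k \<in> {1..N} \<and> x \<in> tensor_power (N - k)}"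
    fix g assume "g \<in> pieces N"
    then obtain x k j where k: "k \<in> {1..N + 1}" and x: "is_local (N - k) (entry x)"
      and g: "\<And>s t. entry g s t = entry x s t * of_bool (pattern N k j t)"
      by (auto simp: pieces_def)
    show "g \<in> complex_vector.span ?G"
    proof (cases "k = N + 1")
      case True
      have "g = entry x (\<lambda>i. 2) (\<lambda>i. 2) *\<^sub>C alpha N j"
      proof (rule alg_uhf_eqI)
        fix s t
        have "is_local 0 (entry x)" using x True by simp
        from is_local_0[OF this, of s t]
        show "entry g s t = entry (entry x (\<lambda>i. 2) (\<lambda>i. 2) *\<^sub>C alpha N j) s t"
          by (simp add: g scaleC_alg_uhf.rep_eq entry_alpha True)
      qed
      then show ?thesis
        by (simp add: complex_vector.span_scale complex_vector.span_base)
    next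
      case False
      then have k': "k \<in> {1..N}" using k by auto
      have "g = tensor (N - k) x (beta k j)"
        by (rule alg_uhf_eqI) (simp only: g entry_tensor_beta[OF k' x])
      then have "g \<in> ?G" using k' x in_tensor_power_iff by blast
      then show ?thesis by (rule complex_vector.span_base)
    qed
  qed
qed

section \<open>Products and adjoints in the finite-dimensional algebras\<close>

lemma subspace_fin_subalgebra: "complex_vector.subspace (fin_subalgebra N)"
  unfolding fin_subalgebra_eq by (rule complex_vector.subspace_span)

lemma fin_subalgebra_induct [consumes 1, case_names subspace piece]:
  assumes "a \<in> fin_subalgebra N" "complex_vector.subspace {a. P a}"
    "\<And>g x k j. k \<in> {1..N + 1} \<Longrightarrow> is_local (N - k) (entry x) \<Longrightarrow>
      (\<And>s t. entry g s t = entry x s t * of_bool (pattern N k j t)) \<Longrightarrow> P g"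
  shows "P a"
  using complex_vector.span_induct[OF assms(1)[unfolded fin_subalgebra_eq] assms(2)] assms(3)
  unfolding pieces_def by blast

lemma pieceI:
  assumes "k \<in> {1..N + 1}" "is_local (N - k) (entry x)"
    "\<And>s t. entry g s t = entry x s t * of_bool (pattern N k j t)"
  shows "g \<in> fin_subalgebra N"
  unfolding fin_subalgebra_eq pieces_def using assms by (intro complex_vector.span_base) blast

lemma fin_subalgebra_zero: "0 \<in> fin_subalgebra N"
  using subspace_fin_subalgebra complex_vector.subspace_0 by blast

text \<open>A nonzero entry of x forces s and t to agree wherever the pattern looks; in other words,
  x commutes with the projection onto the pattern.\<close>

lemma pattern_of_local:
  assumes "is_local (N - k) (entry x)" "entry x s t \<noteq> 0"
  shows "pattern N k j s = pattern N k j t"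
  by (rule pattern_cong_ge) (rule is_localD[OF assms])

text \<open>By bilinearity two pieces suffice. As x and y commute with their pattern projections,
  distinct patterns give the product 0 by \<open>pattern_unique\<close>, and equal ones give the
  piece of \<open>x * y\<close>.\<close>

lemma fin_subalgebra_mult:
  assumes a: "a \<in> fin_subalgebra N" and b: "b \<in> fin_subalgebra N"
  shows "a * b \<in> fin_subalgebra N"
  using a
proof (induction rule: fin_subalgebra_induct)
  case subspace
  show ?case using subspace_fin_subalgebra[of N]
    by (auto simp: complex_vector.subspace_def distrib_right mult_scaleC_left)
next
  case g: (piece g x k j)
  show ?case using b
  proof (induction rule: fin_subalgebra_induct)
    case subspace
    show ?case using subspace_fin_subalgebra[of N]
      by (auto simp: complex_vector.subspace_def distrib_left mult_scaleC_right)
  next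
    case h: (piece h y l i)
    \<comment> \<open>A common level for g and x writes both products as sums over the same tail
      class.\<close>
    obtain M where M: "is_local M (entry g)" "is_local M (entry x)" by (rule is_local_entry2)
    have e: "entry (g * h) s t =
        (\<Sum>u\<in>tail_class M s. entry x s u * entry y u t * of_bool (pattern N k j t \<and> pattern N l i t))" for s t
      unfolding entry_mult_tail[OF M(1)]
    proof (rule sum.cong[OF refl])
      fix u
      show "entry g s u * entry h u t =
          entry x s u * entry y u t * of_bool (pattern N k j t \<and> pattern N l i t)"
      proof (cases "entry y u t = 0 \<or> \<not> pattern N l i t")
        case True
        then show ?thesis by (auto simp: g(3) h(3))
      next
        case False
        \<comment> \<open>The factor h tests its pattern at t, but g tests its own at the
          intermediate word u. A nonzero entry of y carries the pattern of h over to u, where the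
          two can be compared.\<close>
        then have "pattern N l i u" using pattern_of_local[OF h(2)] by blast
        show ?thesis
        proof (cases "k = l \<and> j = i")
          case True
          then show ?thesis using False \<open>pattern N l i u\<close> by (simp add: g(3) h(3))
        next
          case neq: False
          have "\<not> pattern N k j u" "\<not> pattern N k j t"
            using pattern_unique g(1) h(1) \<open>pattern N l i u\<close> False neq by blast+
          then show ?thesis by (simp add: g(3) h(3))
        qed
      qed
    qed
    show ?case
    proof (cases "k = l \<and> j = i")
      case True
      then have "is_local (N - k) (entry (x * y))"
        unfolding times_alg_uhf.rep_eq using g(2) h(2) by (blast intro: is_local_mult)
      then show ?thesis
        by (rule pieceI[OF g(1), of _ _ j])
          (use True in \<open>simp add: e entry_mult_tail[OF M(2)] sum_distrib_right\<close>)
    next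
      case False
      then have "(pattern N k j t \<and> pattern N l i t) = False" for t
        using pattern_unique g(1) h(1) by blast
      then have "g * h = 0"
        by (intro alg_uhf_eqI)
          (simp only: e zero_alg_uhf.rep_eq of_bool_eq mult_zero_right sum.neutral_const)
      then show ?thesis by (simp add: fin_subalgebra_zero)
    qed
  qed
qed

lemma is_local_adj:
  assumes "is_local n (entry x)" shows "is_local n (entry (adj x))"
proof -
  obtain a where "entry x = amplify n a" using assms by (auto simp: is_local_iff)
  then have "entry (adj x) = amplify n (\<lambda>v w. cnj (a w v))"
    by (auto simp: adj_alg_uhf.rep_eq amplify_def fun_eq_iff)
  then show ?thesis by (auto simp: is_local_iff)
qed

text \<open>The adjoint moves the pattern test from column to row; both tests agree wherever x has a
  nonzero entry.\<close>

lemma fin_subalgebra_adj: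
  assumes "a \<in> fin_subalgebra N"
  shows "adj a \<in> fin_subalgebra N"
  using assms
proof (induction rule: fin_subalgebra_induct)
  case subspace
  have "adj (0::alg_uhf) = 0" by transfer simp
  then show ?case using subspace_fin_subalgebra[of N]
    by (auto simp: complex_vector.subspace_def adj_add adj_scaleC)
next
  case g: (piece g x k j)
  show ?case
  proof (rule pieceI[OF g(1) is_local_adj[OF g(2)], of _ j])
    fix s t
    show "entry (adj g) s t = entry (adj x) s t * of_bool (pattern N k j t)"
      using pattern_of_local[OF g(2), of t s j]
      by (cases "entry x t s = 0") (simp_all add: adj_alg_uhf.rep_eq g(3))
  qed
qed

lemma subspace_tensor_power: "complex_vector.subspace (tensor_power n)"
proof (rule complex_vector.subspaceI)
  have "entry 0 = amplify n (\<lambda>v w. 0)"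
    by (intro ext) (simp add: amplify_def zero_alg_uhf.rep_eq)
  then show "0 \<in> tensor_power n" unfolding tensor_power_def by blast
next
  fix x y assume "x \<in> tensor_power n" "y \<in> tensor_power n"
  then obtain a b where xy: "entry x = amplify n a" "entry y = amplify n b"
    unfolding tensor_power_def by blast
  have "entry (x + y) = amplify n (\<lambda>v w. a v w + b v w)"
    by (intro ext) (auto simp: plus_alg_uhf.rep_eq xy amplify_def)
  then show "x + y \<in> tensor_power n" unfolding tensor_power_def by blast
next
  fix c x assume "x \<in> tensor_power n"
  then obtain a where x: "entry x = amplify n a" unfolding tensor_power_def by blast
  have "entry (c *\<^sub>C x) = amplify n (\<lambda>v w. c * a v w)"
    by (intro ext) (auto simp: scaleC_alg_uhf.rep_eq x amplify_def)
  then show "c *\<^sub>C x \<in> tensor_power n" unfolding tensor_power_def by blast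
qed

text \<open>Both x and the pattern involve only the letters 0 to N. The finite dimension follows
  from this.\<close>

lemma fin_subalgebra_local:
  assumes "a \<in> fin_subalgebra N"
  shows "is_local (N + 1) (entry a)"
  using assms
proof (induction rule: fin_subalgebra_induct)
  case subspace
  show ?case
    using subspace_tensor_power[of "N + 1"] by (simp flip: in_tensor_power_iff)
next
  case g: (piece g x k j)
  have x: "is_local (N + 1) (entry x)" by (rule is_local_mono[OF g(2)]) simp
  show ?case
    unfolding is_local_def
  proof (intro conjI allI impI)
    fix s t i assume "entry g s t \<noteq> 0" "N + 1 \<le> i"
    then show "s i = t i" using is_localD[OF x, of s t] by (simp add: g(3))
  next
    fix s t s' t' :: index_word
    assume 1: "\<forall>i\<ge>N + 1. s i = t i \<and> s' i = t' i" and 2: "\<forall>i<N + 1. s i = s' i \<and> t i = t' i"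
    have "entry x s t = entry x s' t'" by (rule is_local_cong[OF x]) (use 1 2 in auto)
    moreover have "pattern N k j t = pattern N k j t'"
      by (rule pattern_cong_le) (use 2 g(1) in auto)
    ultimately show "entry g s t = entry g s' t'" by (simp add: g(3))
  qed
qed

section \<open>The slice map on the subalgebras\<close>

text \<open>With P the projection onto these words, this is P a = P a P. A nonzero entry of a piece
  makes its pattern match s as well as u. As s has only 2's beyond n, \<open>pattern_letter\<close>
  forces \<open>N - k\<close> to be at most n, so x moves no letter beyond n.\<close>

lemma fin_subalgebra_preserves_words:
  assumes "a \<in> fin_subalgebra N" "n \<le> N"
  shows "\<forall>s u. s \<in> words (n + 1) \<longrightarrow> u \<notin> words (n + 1) \<longrightarrow> entry a s u = 0"
  using assms(1)
proof (induction rule: fin_subalgebra_induct)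
  case subspace
  show ?case
    unfolding complex_vector.subspace_def
    by (auto simp: zero_alg_uhf.rep_eq plus_alg_uhf.rep_eq scaleC_alg_uhf.rep_eq)
next
  case g: (piece g x k j)
  show ?case
  proof (intro allI impI, rule ccontr)
    fix s u assume s: "s \<in> words (n + 1)" and u: "u \<notin> words (n + 1)" and "entry g s u \<noteq> 0"
    then have x: "entry x s u \<noteq> 0" and "pattern N k j u" by (auto simp: g(3))
    then have p: "pattern N k j s" using pattern_of_local[OF g(2)] by blast
    have "N - k \<le> n"
    proof (rule ccontr)
      assume "\<not> N - k \<le> n"
      then have "k \<le> N" "s (N + 1 - k) = 2" using s by (auto simp: tail_class_def)
      then show False using pattern_letter[OF p] by blast
    qed
    then have "s i = u i" if "i \<ge> n + 1" for i
      using is_localD[OF g(2) x, of i] that by simp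
    then show False using s u by (simp add: tail_class_def)
  qed
qed

text \<open>P a = P a P implies P a b P = (P a P) (P b P): only intermediate words in the range of P
  contribute.\<close>

lemma slice_mult:
  assumes a: "a \<in> fin_subalgebra N" and "n \<le> N"
  shows "slice (n + 1) (a * b) = slice (n + 1) a * slice (n + 1) b"
proof (rule alg_uhf_eqI)
  fix s t
  define m where "m = n + 1"
  obtain M where "is_local M (entry a)" by (rule is_local_entry)
  \<comment> \<open>A level of at least m makes the tail class of a cut word contain all of
    \<open>words m\<close>.\<close>
  then have M: "is_local (max M m) (entry a)" by (rule is_local_mono) simp
  have "entry (slice m (a * b)) s t = entry (slice m a * slice m b) s t"
  proof (cases "\<forall>i\<ge>m. s i = t i")
    case True
    have "entry (slice m (a * b)) s t =
        (\<Sum>u\<in>tail_class (max M m) (cut m s). entry a (cut m s) u * entry b u (cut m t))"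
      using True by (simp add: entry_slice entry_mult_tail[OF M])
    also have "\<dots> = (\<Sum>u\<in>words m. entry a (cut m s) u * entry b u (cut m t))"
    proof (rule sum.mono_neutral_right[OF finite_tail_class])
      show "words m \<subseteq> tail_class (max M m) (cut m s)"
        by (auto simp: tail_class_def cut_def)
      show "\<forall>u\<in>tail_class (max M m) (cut m s) - words m. entry a (cut m s) u * entry b u (cut m t) = 0"
        using fin_subalgebra_preserves_words[OF a assms(2)] cut_in_words unfolding m_def by auto
    qed
    also have "\<dots> = (\<Sum>u\<in>tail_class m s. entry (slice m a) s u * entry (slice m b) u t)"
    \<comment> \<open>The bijection exchanges the tail of 2's for the tail of s.\<close>
    proof (rule sum.reindex_bij_witness[of _ "cut m" "\<lambda>u i. if i < m then u i else s i"])
      fix u assume u: "u \<in> words m"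
      let ?u = "\<lambda>i. if i < m then u i else s i"
      show "cut m ?u = u" "?u \<in> tail_class m s" using u by (auto simp: cut_def tail_class_def fun_eq_iff)
      then show "entry (slice m a) s ?u * entry (slice m b) ?u t = entry a (cut m s) u * entry b u (cut m t)"
        using True by (simp add: entry_slice)
    next
      fix u assume "u \<in> tail_class m s"
      then show "(\<lambda>i. if i < m then cut m u i else s i) = u" "cut m u \<in> words m"
        by (auto simp: cut_def tail_class_def fun_eq_iff)
    qed
    also have "\<dots> = entry (slice m a * slice m b) s t"
      by (rule entry_mult_tail[OF is_local_slice, symmetric])
    finally show ?thesis .
  next
    case False
    have "is_local m (entry (slice m a * slice m b))"
      unfolding times_alg_uhf.rep_eq by (intro is_local_mult is_local_slice)
    then show ?thesis using is_localD[OF is_local_slice[of m "a * b"]] is_localD False by metis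
  qed
  then show "entry (slice (n + 1) (a * b)) s t = entry (slice (n + 1) a * slice (n + 1) b) s t"
    by (simp add: m_def)
qed

lemma slice_zero: "slice n 0 = 0"
  using slice_scaleC[of n 0 0] by simp

text \<open>If the letter 1 or 3 of a pattern falls beyond n, the slice of the piece is 0. Otherwise
  the pattern loses N - n of its trailing 2's and becomes a pattern for n, with the same x.\<close>

lemma slice_fin_subalgebra:
  assumes "a \<in> fin_subalgebra N" and n: "n \<le> N"
  shows "slice (n + 1) a \<in> fin_subalgebra n"
  using assms(1)
proof (induction rule: fin_subalgebra_induct)
  case subspace
  show ?case using subspace_fin_subalgebra[of n]
    by (auto simp: complex_vector.subspace_def slice_add slice_scaleC slice_zero)
next
  case g: (piece g x k j)
  show ?case
  proof (cases "k \<le> N - n")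
    case True
    have "\<not> pattern N k j (cut (n + 1) t)" for t
    proof
      assume "pattern N k j (cut (n + 1) t)"
      moreover have "k \<le> N" "cut (n + 1) t (N + 1 - k) = 2" using True g(1) n by (auto simp: cut_def)
      ultimately show False using pattern_letter by blast
    qed
    then have "slice (n + 1) g = 0"
      by (intro alg_uhf_eqI) (simp add: entry_slice g(3) zero_alg_uhf.rep_eq)
    then show ?thesis by (simp add: fin_subalgebra_zero)
  next
    case False
    \<comment> \<open>Lowering k by N - n preserves \<open>N - k\<close>, also for
      \<open>k = N + 1\<close>, where both truncated differences are 0.\<close>
    define l where "l = k - (N - n)"
    have k: "k = l + (N - n)" and l: "l \<in> {1..n + 1}" and loc: "N - k = n - l"
      using False g(1) n by (auto simp: l_def)
    have x: "is_local (n - l) (entry x)" using g(2) by (simp only: loc)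
    have p: "pattern N k j (cut (n + 1) t) = pattern n l j t" for t
    proof -
      have "(\<forall>i\<in>{N + 2 - k..N}. cut (n + 1) t i = 2) \<longleftrightarrow> (\<forall>i\<in>{n + 2 - l..n}. t i = 2)"
        using k n by (auto simp: cut_def)
      moreover have "N + 1 - k = n + 1 - l" "k = N + 1 \<longleftrightarrow> l = n + 1" using k n l by auto
      moreover have "n + 1 - l < n + 1" "n - l < n + 1" using l by auto
      ultimately show ?thesis unfolding pattern_def loc by (simp add: cut_def)
    qed
    show ?thesis
    proof (rule pieceI[OF l x, of _ j])
      fix s t
      show "entry (slice (n + 1) g) s t = entry x s t * of_bool (pattern n l j t)"
      proof (cases "\<forall>i\<ge>n + 1. s i = t i")
        case True
        have "is_local (n + 1) (entry x)" by (rule is_local_mono[OF x]) simp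
        then have "entry x (cut (n + 1) s) (cut (n + 1) t) = entry x s t"
          by (rule is_local_cong) (use True in \<open>auto simp: cut_def\<close>)
        then show ?thesis by (simp only: entry_slice if_P[OF True] g(3) p)
      next
        case False
        then have "entry x s t = 0" using is_localD[OF x, of s t] by force
        then show ?thesis unfolding entry_slice if_not_P[OF False] by simp
      qed
    qed
  qed
qed

section \<open>The closed subalgebras of the completion\<close>

lemma to_completion_zero: "to_completion 0 = (0::'a::pre_cstar_algebra completion)"
  using to_completion_diff[of 0 "0::'a"] by simp

lemma subspace_to_completion_image:
  assumes V: "complex_vector.subspace V"
  shows "complex_vector.subspace (to_completion ` V)"
proof (rule complex_vector.subspaceI)
  show "0 \<in> to_completion ` V"
    using complex_vector.subspace_0[OF V] to_completion_zero by (metis imageI)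
next
  fix a b assume "a \<in> to_completion ` V" "b \<in> to_completion ` V"
  then show "a + b \<in> to_completion ` V"
    using complex_vector.subspace_add[OF V] by (elim imageE) (metis imageI to_completion_add)
next
  fix c a assume "a \<in> to_completion ` V"
  then show "c *\<^sub>C a \<in> to_completion ` V"
    using complex_vector.subspace_scale[OF V] by (elim imageE) (metis imageI to_completion_scaleC)
qed

text \<open>The image lies in the span of the finitely many matrix units of n + 1 tensor
  factors.\<close>

lemma closed_fin_subalgebra: "closed (to_completion ` fin_subalgebra n)"
proof (rule closed_complex_subspace_finite)
  let ?E = "(\<lambda>(v, w). to_completion (word_unit (n + 1) v w)) ` (words (n + 1) \<times> words (n + 1))"
  show "finite ?E" by (simp add: finite_tail_class)
  show "to_completion ` fin_subalgebra n \<subseteq> complex_vector.span ?E"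
  proof
    fix a assume "a \<in> to_completion ` fin_subalgebra n"
    then obtain x where x: "x \<in> fin_subalgebra n" and a: "a = to_completion x" by blast
    have "a = (\<Sum>(v, w)\<in>words (n + 1) \<times> words (n + 1). entry x v w *\<^sub>C to_completion (word_unit (n + 1) v w))"
      unfolding a
      by (subst local_expansion[OF fin_subalgebra_local[OF x]])
        (simp add: to_completion_sum case_prod_unfold to_completion_scaleC)
    also have "\<dots> \<in> complex_vector.span ?E"
      by (intro complex_vector.span_sum)
        (auto intro: complex_vector.span_scale[OF complex_vector.span_base])
    finally show "a \<in> complex_vector.span ?E" .
  qed
qed (intro subspace_to_completion_image subspace_fin_subalgebra)

lemma cstar_subalgebra_finite: "cstar_subalgebra (to_completion ` fin_subalgebra n)"
  unfolding cstar_subalgebra_def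
proof (intro conjI ballI)
  fix a b assume "a \<in> to_completion ` fin_subalgebra n" "b \<in> to_completion ` fin_subalgebra n"
  then show "a * b \<in> to_completion ` fin_subalgebra n"
    by (elim imageE) (metis imageI to_completion_mult fin_subalgebra_mult)
next
  fix a assume "a \<in> to_completion ` fin_subalgebra n"
  then show "adj a \<in> to_completion ` fin_subalgebra n"
    by (elim imageE) (metis imageI to_completion_adj fin_subalgebra_adj)
qed (intro subspace_to_completion_image subspace_fin_subalgebra closed_fin_subalgebra)+

text \<open>The operations act term by term on approximating sequences. For closedness, the
  sequences are first replaced by their images in the completion, so that
  \<open>closed_limits_of_sets\<close> applies.\<close>

lemma cstar_subalgebra_infinite: "cstar_subalgebra (subalgebra \<infinity>)"
proof -
  note sub = subspace_fin_subalgebra[unfolded complex_vector.subspace_def]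
  have A: "a \<in> subalgebra \<infinity> \<longleftrightarrow>
      (\<exists>x. (\<forall>n. x n \<in> fin_subalgebra n) \<and> (\<lambda>n. to_completion (x n)) \<longlonglongrightarrow> a)" for a
    by (simp add: subalgebra_def)
  have "a \<in> subalgebra \<infinity> \<longleftrightarrow>
      (\<exists>y. (\<forall>n. y n \<in> to_completion ` fin_subalgebra n) \<and> y \<longlonglongrightarrow> a)" (is "_ \<longleftrightarrow> ?R") for a
  proof
    assume "a \<in> subalgebra \<infinity>"
    then obtain x where "\<forall>n. x n \<in> fin_subalgebra n" "(\<lambda>n. to_completion (x n)) \<longlonglongrightarrow> a"
      unfolding A by blast
    then show ?R by (intro exI[of _ "\<lambda>n. to_completion (x n)"]) simp
  next
    assume ?R
    then obtain y where y: "\<forall>n. y n \<in> to_completion ` fin_subalgebra n" "y \<longlonglongrightarrow> a" by blast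
    then have "\<forall>n. \<exists>x. x \<in> fin_subalgebra n \<and> y n = to_completion x" by blast
    then obtain x where x: "\<And>n. x n \<in> fin_subalgebra n" "\<And>n. y n = to_completion (x n)" by metis
    have "y = (\<lambda>n. to_completion (x n))" by (rule ext) (rule x(2))
    then show "a \<in> subalgebra \<infinity>" unfolding A using y(2) x(1) by blast
  qed
  then have "subalgebra \<infinity> = {a. \<exists>y. (\<forall>n. y n \<in> to_completion ` fin_subalgebra n) \<and> y \<longlonglongrightarrow> a}"
    (is "_ = ?L") by blast
  moreover have "closed ?L" using fin_subalgebra_zero by (intro closed_limits_of_sets) blast
  ultimately have "closed (subalgebra \<infinity>)" by simp
  moreover have "complex_vector.subspace (subalgebra \<infinity>)"
    unfolding complex_vector.subspace_def
  proof (intro conjI ballI allI)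
    show "0 \<in> subalgebra \<infinity>"
      unfolding A using fin_subalgebra_zero
      by (intro exI[of _ "\<lambda>n. 0"]) (simp add: to_completion_zero)
  next
    fix a b assume "a \<in> subalgebra \<infinity>" "b \<in> subalgebra \<infinity>"
    then obtain x y where "\<forall>n. x n \<in> fin_subalgebra n" "\<forall>n. y n \<in> fin_subalgebra n"
      "(\<lambda>n. to_completion (x n)) \<longlonglongrightarrow> a" "(\<lambda>n. to_completion (y n)) \<longlonglongrightarrow> b" unfolding A by blast
    then show "a + b \<in> subalgebra \<infinity>"
      unfolding A using sub
      by (intro exI[of _ "\<lambda>n. x n + y n"]) (simp add: to_completion_add tendsto_add)
  next
    fix c a assume "a \<in> subalgebra \<infinity>"
    then obtain x where "\<forall>n. x n \<in> fin_subalgebra n" "(\<lambda>n. to_completion (x n)) \<longlonglongrightarrow> a" unfolding A by blast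
    then show "c *\<^sub>C a \<in> subalgebra \<infinity>"
      unfolding A using sub bounded_linear.tendsto[OF bounded_linear_scaleC]
      by (intro exI[of _ "\<lambda>n. c *\<^sub>C x n"]) (simp add: to_completion_scaleC)
  qed
  moreover have "a * b \<in> subalgebra \<infinity>" if ab: "a \<in> subalgebra \<infinity>" "b \<in> subalgebra \<infinity>" for a b
  proof -
    obtain x y where "\<forall>n. x n \<in> fin_subalgebra n" "\<forall>n. y n \<in> fin_subalgebra n"
      "(\<lambda>n. to_completion (x n)) \<longlonglongrightarrow> a" "(\<lambda>n. to_completion (y n)) \<longlonglongrightarrow> b"
      using ab unfolding A by blast
    then show ?thesis
      unfolding A
      by (intro exI[of _ "\<lambda>n. x n * y n"])
        (simp add: to_completion_mult tendsto_mult fin_subalgebra_mult)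
  qed
  moreover have "adj a \<in> subalgebra \<infinity>" if a: "a \<in> subalgebra \<infinity>" for a
  proof -
    obtain x where "\<forall>n. x n \<in> fin_subalgebra n" "(\<lambda>n. to_completion (x n)) \<longlonglongrightarrow> a"
      using a unfolding A by blast
    then show ?thesis
      unfolding A using bounded_linear.tendsto[OF bounded_linear_adj]
      by (intro exI[of _ "\<lambda>n. adj (x n)"]) (simp add: to_completion_adj fin_subalgebra_adj)
  qed
  ultimately show ?thesis unfolding cstar_subalgebra_def by blast
qed

lemma cstar_subalgebra_subalgebra: "cstar_subalgebra (subalgebra N)"
  using cstar_subalgebra_finite cstar_subalgebra_infinite
  by (cases N) (simp_all add: subalgebra_def)

text \<open>Treats finite and infinite k alike, by a constant sequence or by one shifted by n; the
  shift brings every level up to at least n, as the slice lemmas require.\<close>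

lemma subalgebra_approx:
  assumes "a \<in> subalgebra (enat n + k)"
  obtains x where "\<And>i. \<exists>N\<ge>n. x i \<in> fin_subalgebra N" "(\<lambda>i. to_completion (x i)) \<longlonglongrightarrow> a"
proof (cases k)
  case (enat m)
  then obtain y where "y \<in> fin_subalgebra (n + m)" "a = to_completion y"
    using assms by (auto simp: subalgebra_def)
  then show ?thesis by (intro that[of "\<lambda>i. y"]) (auto intro: exI[of _ "n + m"])
next
  case infinity
  then obtain y where y: "\<forall>i. y i \<in> fin_subalgebra i" "(\<lambda>i. to_completion (y i)) \<longlonglongrightarrow> a"
    using assms by (auto simp: subalgebra_def)
  show ?thesis
    using y LIMSEQ_ignore_initial_segment[OF y(2), of n]
    by (intro that[of "\<lambda>i. y (i + n)"]) (auto intro!: exI[of _ "_ + n"])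
qed

theorem proposition2p16:
  fixes n :: nat and k :: enat
  shows "cstar_morphism (subalgebra (enat n + k)) (subalgebra (enat n)) (slice_map n state22)"
proof -
  let ?f = "slice_ext (n + 1)"
  have lim: "(\<lambda>i. to_completion (slice (n + 1) (x i))) \<longlonglongrightarrow> ?f a"
    if "(\<lambda>i. to_completion (x i)) \<longlonglongrightarrow> a" for x a
    using bounded_linear.tendsto[OF _ that, of ?f] bounded_clinear_slice_ext
    by (simp add: bounded_clinear_def slice_ext_to_completion)
  have "?f a \<in> subalgebra (enat n)" if a: "a \<in> subalgebra (enat n + k)" for a
  proof -
    obtain x where x: "\<And>i. \<exists>N\<ge>n. x i \<in> fin_subalgebra N" "(\<lambda>i. to_completion (x i)) \<longlonglongrightarrow> a"
      using subalgebra_approx[OF a] by blast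
    have "to_completion (slice (n + 1) (x i)) \<in> to_completion ` fin_subalgebra n" for i
      using x(1)[of i] slice_fin_subalgebra by blast
    \<comment> \<open>The slices of all approximants lie in the image of one fixed algebra, which is
      closed.\<close>
    then show ?thesis
      using closed_sequentially[OF closed_fin_subalgebra _ lim[OF x(2)]]
      by (simp add: subalgebra_def)
  qed
  moreover have "?f (a * b) = ?f a * ?f b"
    if a: "a \<in> subalgebra (enat n + k)" and b: "b \<in> subalgebra (enat n + k)" for a b
  proof -
    obtain x where x: "\<And>i. \<exists>N\<ge>n. x i \<in> fin_subalgebra N" "(\<lambda>i. to_completion (x i)) \<longlonglongrightarrow> a"
      using subalgebra_approx[OF a] by blast
    \<comment> \<open>\<open>slice_mult\<close> constrains only the left factor, so the levels of
      \<open>x i\<close> and \<open>y i\<close> do not have to be matched.\<close>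
    obtain y where y: "(\<lambda>i. to_completion (y i)) \<longlonglongrightarrow> b"
      using subalgebra_approx[OF b] by blast
    have "slice (n + 1) (x i * y i) = slice (n + 1) (x i) * slice (n + 1) (y i)" for i
      using x(1)[of i] slice_mult by blast
    then have "(\<lambda>i. to_completion (slice (n + 1) (x i * y i))) \<longlonglongrightarrow> ?f a * ?f b"
      using tendsto_mult[OF lim[OF x(2)] lim[OF y]] by (simp add: to_completion_mult)
    moreover have "(\<lambda>i. to_completion (slice (n + 1) (x i * y i))) \<longlonglongrightarrow> ?f (a * b)"
      using tendsto_mult[OF x(2) y] by (intro lim) (simp add: to_completion_mult)
    ultimately show ?thesis using LIMSEQ_unique by blast
  qed
  ultimately show ?thesis
    unfolding cstar_morphism_def slice_map_state22
    using cstar_subalgebra_subalgebra slice_ext_add slice_ext_scaleC slice_ext_adj by blast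
qed

end
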